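(* For infinitely many positive integers $n$, there exists an $n$-vertex regular graph $G$, whose (ordinary) adjacency matrix has minimum eigenvalue $\lambda_{\mathrm{min}}$ and maximum eigenvalue $\lambda_{\mathrm{max}}$, such that \[ \alpha(G)\le \alpha_q(G)\le \left|\frac{\lambda_{\mathrm{min}}}{\lambda_{\mathrm{max}}-\lambda_{\mathrm{min}}}\right| n \le 4n^{3/4} \qquad\text{and}\qquad n_{\ge 0}(A)\ge \frac n4 \] for every Hermitian weighted adjacency matrix $A$ of $G$.
   Context: All graphs are finite and simple. $\alpha(G)$ denotes the independence number of $G$. For a graph $G$ with vertex set $\{1,\dots,n\}$, a Hermitian weighted adjacency matrix of $G$ is a Hermitian $n\times n$ complex matrix $A$ with $A_{ij}=0$ whenever $ij$ is not an edge of $G$ (in particular $A_{ii}=0$ for all $i$). For a Hermitian matrix $A$, $n_{\ge 0}(A)$ denotes the number of non-negative eigenvalues of $A$, counted with multiplicity. The quantum independence number (of Mančinska and Roberson) is defined as follows. For graphs $G,H$, write $G\to_q H$ if there exist $d\in\mathbb N$ and orthogonal projections $E_{g,h}\in\mathbb C^{d\times d}$ for $g\in V(G)$, $h\in V(H)$ such that $\sum_{h\in V(H)}E_{g,h}=I$ for every $g\in V(G)$, and $E_{g,h}E_{g',h'}=0$ whenever either ($g=g'$ and $h\neq h'$) or ($g$ is adjacent to $g'$ in $G$ and $h$ is not adjacent to $h'$ in $H$, where $h=h'$ counts as non-adjacent). Then $\alpha_q(G)$ is the largest $t$ such that $K_t\to_q \overline{G}$, where $K_t$ is the complete graph on $t$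 vertices and $\overline G$ is the complement of $G$. *)

theory Defs
  imports
    "Graph_Theory.Pair_Digraph"
    "Jordan_Normal_Form.Spectral_Radius"
begin

text \<open>
  A finite simple graph is a \<^locale>\<open>pair_graph\<close>: a finite vertex set \<^term>\<open>pverts G\<close> together with
  a symmetric irreflexive relation \<^term>\<open>parcs G\<close> on it.  Each edge \<open>uv\<close> occurs as the two arcs
  \<open>(u,v)\<close> and \<open>(v,u)\<close>, so the degree of a vertex is its \<^const>\<open>out_degree\<close>.
\<close>

definition regular_graph :: "'a pair_pre_digraph \<Rightarrow> bool" where
  "regular_graph G \<longleftrightarrow> pair_graph G \<and> (\<exists>k. \<forall>v\<in>pverts G. out_degree (with_proj G) v = k)"

definition complete_graph :: "nat \<Rightarrow> nat pair_pre_digraph" where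
  "complete_graph t = \<lparr> pverts = {..<t}, parcs = {(u,v). u < t \<and> v < t \<and> u \<noteq> v} \<rparr>"

definition complement_graph :: "'a pair_pre_digraph \<Rightarrow> 'a pair_pre_digraph" where
  "complement_graph G = \<lparr> pverts = pverts G,
     parcs = {(u,v). u \<in> pverts G \<and> v \<in> pverts G \<and> u \<noteq> v \<and> (u,v) \<notin> parcs G} \<rparr>"

definition independent_set :: "'a pair_pre_digraph \<Rightarrow> 'a set \<Rightarrow> bool" where
  "independent_set G S \<longleftrightarrow> S \<subseteq> pverts G \<and> (\<forall>u\<in>S. \<forall>v\<in>S. (u,v) \<notin> parcs G)"

definition independence_number :: "'a pair_pre_digraph \<Rightarrow> nat" where
  "independence_number G = Max {card S | S. independent_set G S}"

definition hermitian_mat :: "complex mat \<Rightarrow> bool" where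
  "hermitian_mat A \<longleftrightarrow> square_mat A \<and> mat_adjoint A = A"

definition orthogonal_projection :: "nat \<Rightarrow> complex mat \<Rightarrow> bool" where
  "orthogonal_projection d P \<longleftrightarrow> P \<in> carrier_mat d d \<and> hermitian_mat P \<and> P * P = P"

text \<open>
  The dimension \<open>d\<close> has to be positive: for \<open>d = 0\<close> all conditions hold trivially.  The sum of the
  matrices \<open>E g h\<close> over \<open>h\<close> is written entrywise, since \<^typ>\<open>complex mat\<close> has no
  dimension-independent zero.  No arc of \<open>H\<close> is a loop, so \<open>h = h'\<close> counts as non-adjacent.
\<close>

definition quantum_hom :: "'a pair_pre_digraph \<Rightarrow> 'b pair_pre_digraph \<Rightarrow> bool" where
  "quantum_hom G H \<longleftrightarrow> (\<exists>d>0. \<exists>E :: 'a \<Rightarrow> 'b \<Rightarrow> complex mat.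
     (\<forall>g\<in>pverts G. \<forall>h\<in>pverts H. orthogonal_projection d (E g h)) \<and>
     (\<forall>g\<in>pverts G. mat d d (\<lambda>ij. \<Sum>h\<in>pverts H. E g h $$ ij) = 1\<^sub>m d) \<and>
     (\<forall>g\<in>pverts G. \<forall>g'\<in>pverts G. \<forall>h\<in>pverts H. \<forall>h'\<in>pverts H.
        (g = g' \<and> h \<noteq> h') \<or> ((g,g') \<in> parcs G \<and> (h,h') \<notin> parcs H)
          \<longrightarrow> E g h * E g' h' = 0\<^sub>m d d))"

definition quantum_independence_number :: "'a pair_pre_digraph \<Rightarrow> nat" where
  "quantum_independence_number G = Max {t. quantum_hom (complete_graph t) (complement_graph G)}"

text \<open>
  Matrix indices start at 0, so the matrices below are those of a graph whose vertex set is
  \<open>{..<n}\<close> (in place of \<open>{1..n}\<close>).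
\<close>

definition adjacency_matrix :: "nat pair_pre_digraph \<Rightarrow> real mat" where
  "adjacency_matrix G =
     mat (card (pverts G)) (card (pverts G)) (\<lambda>(i,j). if (i,j) \<in> parcs G then 1 else 0)"

definition lambda_min :: "nat pair_pre_digraph \<Rightarrow> real" where
  "lambda_min G = Min (spectrum (adjacency_matrix G))"

definition lambda_max :: "nat pair_pre_digraph \<Rightarrow> real" where
  "lambda_max G = Max (spectrum (adjacency_matrix G))"

definition hermitian_weighted_adjacency_matrix ::
    "nat pair_pre_digraph \<Rightarrow> complex mat \<Rightarrow> bool" where
  "hermitian_weighted_adjacency_matrix G A \<longleftrightarrow>
     A \<in> carrier_mat (card (pverts G)) (card (pverts G)) \<and> hermitian_mat A \<and>
     (\<forall>i\<in>pverts G. \<forall>j\<in>pverts G. (i,j) \<notin> parcs G \<longrightarrow> A $$ (i,j) = 0)"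

text \<open>
  \<^const>\<open>proots\<close> lists every root with its multiplicity.  The eigenvalues of a Hermitian matrix are
  real, so there the condition \<open>x \<in> \<real>\<close> removes nothing.
\<close>

definition num_nonneg_eigenvalues :: "complex mat \<Rightarrow> nat" where
  "num_nonneg_eigenvalues A = size {# x \<in># proots (char_poly A). x \<in> \<real> \<and> 0 \<le> Re x #}"

end

theory Submission
  imports Defs "HOL-Number_Theory.Cong"
begin

text \<open>
  The graph is a dense graph without triangles and four-cycles.  Let \<open>p\<close> be a prime modulo which
  \<open>-1 = i\<^sup>2\<close> is a square and let \<open>g\<close> be a nonresidue.  On the affine plane over the field with \<open>p\<close>
  elements join \<open>(a, b)\<close> and \<open>(c, d)\<close> when \<open>b + d = a c\<close>; two points have at most one common
  neighbour.  In a triangle the discriminants \<open>2 b - a\<^sup>2\<close> multiply to a square, so the subgraph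
  induced on the points whose discriminant is \<open>g\<close> times a nonzero square has no triangle, and
  scaling shows that it is regular, of degree at least \<open>(p - 1) / 2\<close>.

  Counting common neighbours, the square of the adjacency matrix of the plane is \<open>p I + J - K\<close> with
  \<open>K\<close> positive semidefinite, hence the smallest eigenvalue is at least \<open>- sqrt p\<close>.  This bounds the
  ratio bound by \<open>4 n powr (3/4)\<close>, and Hoffman's argument applied entrywise to a quantum independent
  set shows that it dominates the quantum independence number.

  For the inertia, a small perturbation makes a weighted adjacency matrix nonzero on all edges without
  creating nonnegative eigenvalues, and a diagonal congruence then makes all its rows have squared
  norm close to 2.  Absence of short cycles determines the moments of the eigenvalues:
  the traces of the first and third powers vanish, that of the second is \<open>2 n\<close>, and that of the fourth
  is at most \<open>8 n\<close>.  The polynomial \<open>z (z + 2)\<^sup>2 (3 - z)\<close>, which is at most 32 for \<open>z \<ge> 0\<close> and at most 0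
  for \<open>z < 0\<close>, turns these into at least \<open>n / 4\<close> nonnegative eigenvalues.
\<close>

section \<open>Spectral theorem for Hermitian matrices\<close>

lemma trace_mult_commute:
  fixes X Y :: "'a :: comm_semiring_0 mat"
  assumes "X \<in> carrier_mat n n" "Y \<in> carrier_mat n n"
  shows "(\<Sum>i<n. (X * Y) $$ (i,i)) = (\<Sum>i<n. (Y * X) $$ (i,i))"
proof -
  have *: "(\<Sum>i<n. (U * V) $$ (i,i)) = (\<Sum>i<n. \<Sum>j<n. U $$ (i,j) * V $$ (j,i))"
    if "U \<in> carrier_mat n n" "V \<in> carrier_mat n n" for U V :: "'a mat"
    using that by (intro sum.cong) (auto simp: scalar_prod_def atLeast0LessThan)
  show ?thesis
    unfolding *[OF assms] *[OF assms(2,1)]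
    by (subst sum.swap) (simp add: mult.commute)
qed

text \<open>Schur triangularization shows that the trace is the sum of the \<open>n\<close> roots of
  the characteristic polynomial. If all of them were \<open>c\<close>, the trace would be
  \<open>n * c\<close>.\<close>

lemma eigenvalue_of_trace_neq:
  fixes B :: "nat \<Rightarrow> nat \<Rightarrow> complex"
  assumes "(\<Sum>a<n. B a a) \<noteq> of_nat n * c"
  obtains m x where "m \<noteq> c" "\<exists>a<n. x a \<noteq> 0" "\<And>a. a < n \<Longrightarrow> (\<Sum>b<n. B a b * x b) = m * x a"
proof -
  define M where "M = mat n n (\<lambda>(a,b). B a b)"
  have M: "M \<in> carrier_mat n n" by (simp add: M_def)
  obtain as where as: "char_poly M = (\<Prod>a\<leftarrow>as. [:- a, 1:])" and len: "length as = n"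
    using char_poly_factorized[OF M] by blast
  obtain T P Q where "schur_decomposition M as = (T,P,Q)" by (cases "schur_decomposition M as")
  from schur_decomposition[OF M as this] have sim: "similar_mat_wit M T P Q" and diag: "diag_mat T = as"
    by auto
  note S = similar_mat_witD2[OF M sim]
  have "(\<Sum>a<n. B a a) = (\<Sum>a<n. (P * T * Q) $$ (a,a))"
    unfolding S(3)[symmetric] by (simp add: M_def)
  also have "\<dots> = (\<Sum>a<n. (Q * (P * T)) $$ (a,a))"
    using S by (intro trace_mult_commute) auto
  also have "Q * (P * T) = T"
    using S by (metis assoc_mult_mat left_mult_one_mat)
  also have "(\<Sum>a<n. T $$ (a,a)) = (\<Sum>a<n. as ! a)"
    using S(5) unfolding diag[symmetric] by (intro sum.cong) (auto simp: diag_mat_def)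
  finally have "(\<Sum>a<n. as ! a) \<noteq> (\<Sum>a<n. c)" using assms by simp
  then obtain a where a: "a < n" "as ! a \<noteq> c" by (meson lessThan_iff sum.cong)
  have "poly (char_poly M) (as ! a) = 0"
    unfolding as using a len by (auto simp: poly_prod_list prod_list_zero_iff)
  then obtain v where v: "eigenvector M v (as ! a)"
    using eigenvalue_root_char_poly[OF M] unfolding eigenvalue_def by blast
  show ?thesis
  proof (rule that[of "as ! a" "\<lambda>i. v $ i"])
    show "\<exists>i<n. v $ i \<noteq> 0"
      using v M unfolding eigenvector_def by (auto simp: vec_eq_iff)
    show "(\<Sum>j<n. B i j * v $ j) = as ! a * v $ i" if "i < n" for i
    proof -
      have "(M *\<^sub>v v) $ i = (as ! a \<cdot>\<^sub>v v) $ i" using v unfolding eigenvector_def by simp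
      moreover have "dim_vec v = n" using v M unfolding eigenvector_def by simp
      ultimately show ?thesis using M that
        by (simp add: scalar_prod_def M_def atLeast0LessThan)
    qed
  qed (use a in auto)
qed

text \<open>Fewer equations than unknowns: the system is padded with zero rows to a singular square
  matrix. The index set \<open>J\<close> is arbitrary, so that two families of equations can be
  supplied as a disjoint sum.\<close>

lemma kernel_vector_exists:
  fixes m :: "'j \<Rightarrow> nat \<Rightarrow> 'a :: field"
  assumes "finite J" "card J < n"
  obtains c where "\<exists>i<n. c i \<noteq> 0" "\<And>j. j \<in> J \<Longrightarrow> (\<Sum>i<n. m j i * c i) = 0"
proof -
  obtain h where h: "bij_betw h {..<card J} J"
    using assms(1) by (metis ex_bij_betw_nat_finite atLeast0LessThan)
  define K where "K = mat n n (\<lambda>(r,i). if r < card J then m (h r) i else 0)"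
  have K: "K \<in> carrier_mat n n" by (simp add: K_def)
  have "det K = 0"
  proof (rule ccontr)
    assume "det K \<noteq> 0"
    then have "det (transpose_mat K) \<noteq> 0" using det_transpose[OF K] by simp
    \<comment> \<open>Row \<open>card J\<close> is the first padding row; it is zero, so the
      transpose annihilates this unit vector.\<close>
    moreover have "transpose_mat K *\<^sub>v unit_vec n (card J) = 0\<^sub>v n"
      using assms(2) by (intro eq_vecI) (auto simp: K_def scalar_prod_def)
    moreover have "unit_vec n (card J) \<noteq> 0\<^sub>v n" using assms(2)
      by (metis index_unit_vec(2) index_zero_vec(1) zero_neq_one)
    ultimately show False
      using det_0_iff_vec_prod_zero_field[of "transpose_mat K" n] K
        transpose_carrier_mat K unit_vec_carrier by blast
  qed
  then obtain v where v: "v \<in> carrier_vec n" "v \<noteq> 0\<^sub>v n" "K *\<^sub>v v = 0\<^sub>v n"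
    using det_0_iff_vec_prod_zero_field[OF K] by auto
  show ?thesis
  proof (rule that[of "\<lambda>i. v $ i"])
    show "\<exists>i<n. v $ i \<noteq> 0" using v by (auto simp: vec_eq_iff)
    fix j assume "j \<in> J"
    then obtain r where r: "r < card J" "j = h r" using bij_betw_imp_surj_on[OF h] by (metis imageE lessThan_iff)
    have "(K *\<^sub>v v) $ r = 0" using v(3) r assms(2) by simp
    then show "(\<Sum>i<n. m j i * v $ i) = 0"
      using r assms(2) v(1) by (simp add: K_def scalar_prod_def atLeast0LessThan)
  qed
qed

text \<open>Matrices and vectors are plain functions restricted to indices below \<open>n\<close>;
  this lets a new eigenpair be appended by function update. The number \<open>k\<close> of pairs is
  separate from the dimension \<open>n\<close>, so that partial systems are available for
  induction.\<close>

definition orthonormal_eigensystem ::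
    "nat \<Rightarrow> (nat \<Rightarrow> nat \<Rightarrow> complex) \<Rightarrow> nat \<Rightarrow> (nat \<Rightarrow> nat \<Rightarrow> complex) \<Rightarrow> (nat \<Rightarrow> real) \<Rightarrow> bool" where
  "orthonormal_eigensystem n A k u l \<longleftrightarrow>
     (\<forall>i<k. \<forall>j<k. (\<Sum>a<n. u i a * cnj (u j a)) = of_bool (i = j)) \<and>
     (\<forall>i<k. \<forall>a<n. (\<Sum>b<n. A a b * u i b) = of_real (l i) * u i a)"

lemma sum_of_bool_eq:
  fixes f :: "nat \<Rightarrow> 'a :: semiring_1"
  shows "i < k \<Longrightarrow> (\<Sum>j<k. f j * of_bool (j = i)) = f i"
    "i < k \<Longrightarrow> (\<Sum>j<k. f j * of_bool (i = j)) = f i"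
    "i < k \<Longrightarrow> (\<Sum>j<k. of_bool (j = i) * f j) = f i"
    "i < k \<Longrightarrow> (\<Sum>j<k. of_bool (i = j) * f j) = f i"
  by (simp_all add: of_bool_def if_distrib if_distribR sum.delta sum.delta' cong: if_cong)

lemma hermitian_form_swap:
  fixes B :: "nat \<Rightarrow> nat \<Rightarrow> complex"
  assumes "\<And>a b. a < n \<Longrightarrow> b < n \<Longrightarrow> B b a = cnj (B a b)"
  shows "(\<Sum>a<n. cnj (y a) * (\<Sum>b<n. B a b * x b)) = (\<Sum>a<n. cnj (\<Sum>b<n. B a b * y b) * x a)"
proof -
  have "(\<Sum>a<n. cnj (y a) * (\<Sum>b<n. B a b * x b)) = (\<Sum>b<n. \<Sum>a<n. cnj (y a) * (B a b * x b))"
    unfolding sum_distrib_left by (rule sum.swap)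
  also have "\<dots> = (\<Sum>b<n. \<Sum>a<n. cnj (B b a * y a) * x b)"
  proof (intro sum.cong refl)
    fix a b assume "b \<in> {..<n}" "a \<in> {..<n}"
    then have "B a b = cnj (B b a)" by (intro assms) auto
    then show "cnj (y a) * (B a b * x b) = cnj (B b a * y a) * x b" by simp
  qed
  finally show ?thesis by (simp add: sum_distrib_right)
qed

lemma sum_mult_cnj: "(\<Sum>a\<in>S. x a * cnj (x a)) = of_real (\<Sum>a\<in>S. (cmod (x a))\<^sup>2)"
  by (simp only: of_real_sum complex_norm_square)

lemma hermitian_eigenvalue_real:
  fixes B :: "nat \<Rightarrow> nat \<Rightarrow> complex"
  assumes herm: "\<And>a b. a < n \<Longrightarrow> b < n \<Longrightarrow> B b a = cnj (B a b)"
    and x: "\<exists>a<n. x a \<noteq> 0" "\<And>a. a < n \<Longrightarrow> (\<Sum>b<n. B a b * x b) = m * x a"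
  shows "m = of_real (Re m)"
proof -
  have "(\<Sum>a<n. cnj (x a) * (m * x a)) = (\<Sum>a<n. cnj (m * x a) * x a)"
    using hermitian_form_swap[of n B x x, OF herm] x(2) by simp
  then have "(m - cnj m) * (\<Sum>a<n. cnj (x a) * x a) = 0"
    by (simp add: sum_distrib_left algebra_simps sum_subtractf)
  moreover have "(\<Sum>a<n. cnj (x a) * x a) = of_real (\<Sum>a<n. (cmod (x a))\<^sup>2)"
    unfolding sum_mult_cnj[symmetric] by (simp add: mult.commute)
  moreover have "(\<Sum>a<n. (cmod (x a))\<^sup>2) > 0"
    using x(1) by (auto intro!: sum_pos2)
  ultimately have "m = cnj m" by (metis divisors_zero eq_iff_diff_eq_0 less_irrefl of_real_eq_0_iff)
  then show ?thesis by (simp add: complex_eq_iff)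
qed

text \<open>
  Shifting the eigenvalues already found to a common value \<open>c\<close>, chosen so that the trace prevents
  all eigenvalues from being \<open>c\<close>, yields an eigenvector orthogonal to the previous ones.
\<close>

lemma orthonormal_eigensystem_extend:
  fixes A :: "nat \<Rightarrow> nat \<Rightarrow> complex"
  assumes herm: "\<And>a b. a < n \<Longrightarrow> b < n \<Longrightarrow> A b a = cnj (A a b)"
    and es: "orthonormal_eigensystem n A k u l" and k: "k < n"
  shows "\<exists>u l. orthonormal_eigensystem n A (Suc k) u l"
proof -
  have orth: "(\<Sum>a<n. u i a * cnj (u j a)) = of_bool (i = j)" if "i < k" "j < k" for i j
    using es that unfolding orthonormal_eigensystem_def by blast
  have eig: "(\<Sum>b<n. A a b * u i b) = of_real (l i) * u i a" if "i < k" "a < n" for i a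
    using es that unfolding orthonormal_eigensystem_def by blast
  define tA where "tA = (\<Sum>a<n. A a a)"
  \<comment> \<open>The two sides are affine in \<open>c\<close> with slopes \<open>k\<close> and
    \<open>n\<close>, which differ, so they agree for at most one \<open>c\<close>; one of 0 and 1
    always works.\<close>
  obtain c :: real where c: "tA + (\<Sum>i<k. of_real (c - l i)) \<noteq> of_nat n * of_real c"
  proof (cases "tA = (\<Sum>i<k. of_real (l i))")
    case True
    have "of_nat k \<noteq> (of_nat n :: complex)" using k by simp
    with True show ?thesis by (intro that[of 1]) (simp add: sum_subtractf)
  qed (intro that[of 0], auto simp: sum_negf)
  define B where "B a b = A a b + (\<Sum>i<k. of_real (c - l i) * (u i a * cnj (u i b)))" for a b
  have hermB: "B b a = cnj (B a b)" if "a < n" "b < n" for a b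
    using herm[OF that] by (simp add: B_def mult_ac)
  have "(\<Sum>a<n. B a a) = tA + (\<Sum>i<k. of_real (c - l i) * (\<Sum>a<n. u i a * cnj (u i a)))"
    unfolding B_def tA_def sum.distrib sum_distrib_left by (subst sum.swap) simp
  also have "\<dots> = tA + (\<Sum>i<k. of_real (c - l i))"
    using orth by simp
  finally have "(\<Sum>a<n. B a a) \<noteq> of_nat n * of_real c" using c by simp
  then obtain m x where m: "m \<noteq> of_real c" and x0: "\<exists>a<n. x a \<noteq> 0"
    and x: "\<And>a. a < n \<Longrightarrow> (\<Sum>b<n. B a b * x b) = m * x a"
    using eigenvalue_of_trace_neq[where B = B and n = n and c = "of_real c"] by blast
  have Bx: "(\<Sum>b<n. B a b * y b) = (\<Sum>b<n. A a b * y b)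
      + (\<Sum>i<k. of_real (c - l i) * u i a * (\<Sum>b<n. y b * cnj (u i b)))" for a y
  proof -
    have "(\<Sum>b<n. B a b * y b) = (\<Sum>b<n. A a b * y b)
       + (\<Sum>b<n. \<Sum>i<k. of_real (c - l i) * u i a * (y b * cnj (u i b)))"
      unfolding B_def by (simp add: algebra_simps sum.distrib sum_distrib_left sum_subtractf)
    then show ?thesis by (subst (asm) sum.swap) (simp add: sum_distrib_left)
  qed
  have Bu: "(\<Sum>b<n. B a b * u j b) = of_real c * u j a" if "j < k" "a < n" for j a
  proof -
    have "(\<Sum>i<k. of_real (c - l i) * u i a * (\<Sum>b<n. u j b * cnj (u i b)))
        = (\<Sum>i<k. of_real (c - l i) * u i a * of_bool (j = i))"
      using orth that by (intro sum.cong) auto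
    also have "\<dots> = of_real (c - l j) * u j a"
      using that by (intro sum_of_bool_eq)
    finally show ?thesis unfolding Bx by (simp add: eig that algebra_simps)
  qed
  \<comment> \<open>\<open>x\<close> and \<open>u j\<close> belong to the different eigenvalues
    \<open>m\<close> and \<open>c\<close> of the Hermitian \<open>B\<close>. Orthogonality in turn
    makes the correction terms of \<open>B\<close> vanish on \<open>x\<close>, so \<open>x\<close>
    is an eigenvector of \<open>A\<close> itself.\<close>
  have perp: "(\<Sum>a<n. x a * cnj (u j a)) = 0" if j: "j < k" for j
  proof -
    have "(\<Sum>a<n. cnj (u j a) * (m * x a)) = (\<Sum>a<n. cnj (of_real c * u j a) * x a)"
      using hermitian_form_swap[of n B "u j" x, OF hermB] x Bu j by simp
    then have "(m - of_real c) * (\<Sum>a<n. x a * cnj (u j a)) = 0"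
      by (simp add: sum_distrib_left algebra_simps sum_subtractf)
    then show ?thesis using m by simp
  qed
  have Ax: "(\<Sum>b<n. A a b * x b) = m * x a" if "a < n" for a
    using x[OF that] perp unfolding Bx by simp
  have m': "m = of_real (Re m)"
    using hermitian_eigenvalue_real[OF herm x0 Ax] .
  define s where "s = sqrt (\<Sum>a<n. (cmod (x a))\<^sup>2)"
  have s2: "s\<^sup>2 = (\<Sum>a<n. (cmod (x a))\<^sup>2)" unfolding s_def by (simp add: sum_nonneg)
  have s: "s > 0" unfolding s_def using x0 by (auto intro!: sum_pos2)
  have xx: "(\<Sum>a<n. x a * cnj (x a)) = of_real (s\<^sup>2)"
    unfolding s2 by (rule sum_mult_cnj)
  define u' where "u' = u(k := (\<lambda>a. x a / of_real s))"
  define l' where "l' = l(k := Re m)"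
  have perp': "(\<Sum>a<n. u j a * cnj (x a)) = 0" if "j < k" for j
    using arg_cong[OF perp[OF that], of cnj] by (simp add: mult.commute)
  have "orthonormal_eigensystem n A (Suc k) u' l'"
    unfolding orthonormal_eigensystem_def
  proof (intro conjI allI impI)
    fix i j assume "i < Suc k" "j < Suc k"
    then consider "i < k" "j < k" | "i = k" "j < k" | "i < k" "j = k" | "i = k" "j = k" by linarith
    then show "(\<Sum>a<n. u' i a * cnj (u' j a)) = of_bool (i = j)"
    proof cases
      case 1 then show ?thesis using orth by (simp add: u'_def)
    next
      case 2 then show ?thesis using perp[of j]
        by (simp add: u'_def sum_divide_distrib[symmetric])
    next
      case 3 then show ?thesis using perp'[of i]
        by (simp add: u'_def sum_divide_distrib[symmetric])
    next
      case 4 then show ?thesis using xx s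
        by (simp add: u'_def sum_divide_distrib[symmetric] power2_eq_square)
    qed
  next
    fix i a assume "i < Suc k" "a < n"
    then show "(\<Sum>b<n. A a b * u' i b) = of_real (l' i) * u' i a"
      using eig Ax[of a] m' by (cases "i = k") (auto simp: u'_def l'_def sum_divide_distrib[symmetric])
  qed
  then show ?thesis by blast
qed

theorem hermitian_spectral_theorem:
  fixes A :: "nat \<Rightarrow> nat \<Rightarrow> complex"
  assumes herm: "\<And>a b. a < n \<Longrightarrow> b < n \<Longrightarrow> A b a = cnj (A a b)"
  obtains u l where "orthonormal_eigensystem n A n u l"
proof -
  have "k \<le> n \<Longrightarrow> \<exists>u l. orthonormal_eigensystem n A k u l" for k
  proof (induction k)
    case 0 show ?case by (simp add: orthonormal_eigensystem_def)
  next
    case (Suc k) then show ?case using orthonormal_eigensystem_extend[OF herm] by (meson Suc_leD Suc_le_lessD)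
  qed
  then show ?thesis using that by blast
qed

lemma orthonormal_eigensystemD:
  assumes "orthonormal_eigensystem n A k u l"
  shows "i < k \<Longrightarrow> j < k \<Longrightarrow> (\<Sum>a<n. u i a * cnj (u j a)) = of_bool (i = j)"
    "i < k \<Longrightarrow> a < n \<Longrightarrow> (\<Sum>b<n. A a b * u i b) = of_real (l i) * u i a"
  using assms unfolding orthonormal_eigensystem_def by blast+

text \<open>A one-sided inverse of a square matrix is two-sided: orthonormality of the vectors gives
  the resolution of the identity.\<close>

lemma orthonormal_eigensystem_complete:
  assumes "orthonormal_eigensystem n A n u l" "a < n" "b < n"
  shows "(\<Sum>i<n. u i a * cnj (u i b)) = of_bool (a = b)"
proof -
  define U where "U = mat n n (\<lambda>(i,a). u i a)"
  define V where "V = mat n n (\<lambda>(a,i). cnj (u i a))"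
  have U: "U \<in> carrier_mat n n" and V: "V \<in> carrier_mat n n" by (simp_all add: U_def V_def)
  have "U * V = 1\<^sub>m n"
    using orthonormal_eigensystemD(1)[OF assms(1)]
    by (intro eq_matI) (auto simp: U_def V_def scalar_prod_def atLeast0LessThan)
  then have "V * U = 1\<^sub>m n" by (rule mat_mult_left_right_inverse[OF U V])
  then have "(V * U) $$ (b, a) = of_bool (a = b)" using assms by auto
  then show ?thesis using assms
    by (simp add: U_def V_def scalar_prod_def atLeast0LessThan mult.commute)
qed

section \<open>Functional calculus, eigenvalue counting and quadratic forms\<close>

text \<open>The entries of the operator with eigenvalue \<open>f i\<close> on \<open>u i\<close>.
  Here \<open>f\<close> is a function of the index, so powers of the matrix correspond to pointwise
  powers of \<open>l\<close>.\<close>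

definition spectral_sum :: "nat \<Rightarrow> (nat \<Rightarrow> nat \<Rightarrow> complex) \<Rightarrow> (nat \<Rightarrow> real) \<Rightarrow> nat \<Rightarrow> nat \<Rightarrow> complex" where
  "spectral_sum n u f a b = (\<Sum>i<n. of_real (f i) * (u i a * cnj (u i b)))"

lemma spectral_sum_eigenvalues:
  assumes es: "orthonormal_eigensystem n A n u l" and "a < n" "b < n"
  shows "A a b = spectral_sum n u l a b"
proof -
  have "A a b = (\<Sum>c<n. A a c * (\<Sum>i<n. u i c * cnj (u i b)))"
    using assms(3) by (simp add: orthonormal_eigensystem_complete[OF es] sum_of_bool_eq)
  also have "\<dots> = (\<Sum>i<n. (\<Sum>c<n. A a c * u i c) * cnj (u i b))"
    unfolding sum_distrib_left sum_distrib_right by (subst sum.swap) (simp add: mult_ac)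
  finally show ?thesis
    using assms(2) by (simp add: orthonormal_eigensystemD(2)[OF es] spectral_sum_def mult_ac)
qed

text \<open>Orthonormality collapses the double sum over eigenvectors. Together with the trace
  formula this turns traces of powers into power sums of eigenvalues.\<close>

lemma spectral_sum_mult:
  assumes es: "orthonormal_eigensystem n A n u l"
  shows "(\<Sum>c<n. spectral_sum n u f a c * spectral_sum n u g c b)
    = spectral_sum n u (\<lambda>i. f i * g i) a b"
proof -
  have "(\<Sum>c<n. spectral_sum n u f a c * spectral_sum n u g c b)
    = (\<Sum>c<n. \<Sum>i<n. \<Sum>j<n. of_real (f i) * u i a * (of_real (g j) * cnj (u j b)) * (u j c * cnj (u i c)))"
    unfolding spectral_sum_def sum_product by (simp add: mult_ac)
  also have "\<dots> = (\<Sum>i<n. \<Sum>j<n. \<Sum>c<n. of_real (f i) * u i a * (of_real (g j) * cnj (u j b)) * (u j c * cnj (u i c)))"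
    by (subst sum.swap, rule sum.cong[OF refl], rule sum.swap)
  also have "\<dots> = (\<Sum>i<n. \<Sum>j<n. of_real (f i) * u i a * (of_real (g j) * cnj (u j b)) * of_bool (j = i))"
    by (intro sum.cong refl) (simp add: sum_distrib_left[symmetric] orthonormal_eigensystemD(1)[OF es])
  also have "\<dots> = (\<Sum>i<n. of_real (f i) * u i a * (of_real (g i) * cnj (u i b)))"
    by (intro sum.cong refl sum_of_bool_eq) simp
  finally show ?thesis by (simp add: spectral_sum_def mult_ac)
qed

lemma spectral_sum_trace:
  assumes es: "orthonormal_eigensystem n A n u l"
  shows "(\<Sum>a<n. spectral_sum n u f a a) = of_real (\<Sum>i<n. f i)"
  unfolding spectral_sum_def
  by (subst sum.swap) (simp add: sum_distrib_left[symmetric] orthonormal_eigensystemD(1)[OF es])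

lemma char_poly_orthonormal_eigensystem:
  assumes es: "orthonormal_eigensystem n A n u l"
  shows "char_poly (mat n n (\<lambda>(a,b). A a b)) = (\<Prod>i\<leftarrow>[0..<n]. [:- of_real (l i), 1:])"
proof -
  define M where "M = mat n n (\<lambda>(a,b). A a b)"
  define U where "U = mat n n (\<lambda>(a,i). u i a)"
  define V where "V = mat n n (\<lambda>(i,a). cnj (u i a))"
  define T where "T = mat_diag n (\<lambda>i. complex_of_real (l i))"
  have carr: "M \<in> carrier_mat n n" "U \<in> carrier_mat n n" "V \<in> carrier_mat n n" "T \<in> carrier_mat n n"
    by (simp_all add: M_def U_def V_def T_def)
  have UV: "U * V = 1\<^sub>m n"
    using orthonormal_eigensystem_complete[OF es]
    by (intro eq_matI) (auto simp: U_def V_def scalar_prod_def atLeast0LessThan)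
  then have VU: "V * U = 1\<^sub>m n" by (rule mat_mult_left_right_inverse[OF carr(2,3)])
  have "U * T = mat n n (\<lambda>(a,i). u i a * of_real (l i))"
    unfolding T_def mat_diag_mult_right[OF carr(2)] by (auto simp: U_def intro!: eq_matI)
  then have "U * T * V = M"
    using spectral_sum_eigenvalues[OF es]
    by (intro eq_matI) (auto simp: M_def V_def scalar_prod_def atLeast0LessThan spectral_sum_def mult_ac)
  then have "similar_mat M T"
    using carr UV VU by (intro similar_matI[of _ _ U V n]) auto
  then have "char_poly M = char_poly T" by (rule char_poly_similar)
  also have "\<dots> = (\<Prod>a\<leftarrow>diag_mat T. [:- a, 1:])"
    by (intro char_poly_upper_triangular[of _ n]) (auto simp: T_def mat_diag_def)
  also have "diag_mat T = map (\<lambda>i. of_real (l i)) [0..<n]"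
    by (auto simp: diag_mat_def T_def mat_diag_def)
  finally show ?thesis by (simp add: M_def comp_def)
qed

text \<open>Unitary diagonalization makes the root multiset of the characteristic polynomial the
  list of the \<open>l i\<close>, so eigenvalues with multiplicity can be counted by index from here
  on.\<close>

lemma num_nonneg_eigenvalues_eq_card:
  assumes es: "orthonormal_eigensystem n A n u l"
  shows "num_nonneg_eigenvalues (mat n n (\<lambda>(a,b). A a b)) = card {i. i < n \<and> 0 \<le> l i}"
proof -
  have *: "proots (\<Prod>i\<leftarrow>xs. [:- complex_of_real (l i), 1:]) = mset (map (\<lambda>i. of_real (l i)) xs)" for xs
  proof (induction xs)
    case (Cons x xs)
    have "(\<Prod>i\<leftarrow>xs. [:- complex_of_real (l i), 1:]) \<noteq> 0" by (auto simp: prod_list_zero_iff)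
    then show ?case using Cons by (simp add: proots_mult del: mult_pCons_left)
  qed simp
  have "num_nonneg_eigenvalues (mat n n (\<lambda>(a,b). A a b))
      = length (filter (\<lambda>x. x \<in> \<real> \<and> 0 \<le> Re x) (map (\<lambda>i. of_real (l i)) [0..<n]))"
    unfolding num_nonneg_eigenvalues_def char_poly_orthonormal_eigensystem[OF es] *
    by (simp only: mset_filter[symmetric] size_mset)
  also have "\<dots> = card {i. i < n \<and> 0 \<le> l i}"
    unfolding filter_map length_map comp_def
    by (subst distinct_card[symmetric]) (auto intro!: arg_cong[where f = card])
  finally show ?thesis .
qed

lemma sum_rotate:
  "(\<Sum>a\<in>A. \<Sum>b\<in>B. \<Sum>c\<in>C. f a b c) = (\<Sum>c\<in>C. \<Sum>a\<in>A. \<Sum>b\<in>B. f a b c)"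
proof -
  have "(\<Sum>a\<in>A. \<Sum>b\<in>B. \<Sum>c\<in>C. f a b c) = (\<Sum>a\<in>A. \<Sum>c\<in>C. \<Sum>b\<in>B. f a b c)"
    by (intro sum.cong refl sum.swap)
  also have "\<dots> = (\<Sum>c\<in>C. \<Sum>a\<in>A. \<Sum>b\<in>B. f a b c)" by (rule sum.swap)
  finally show ?thesis .
qed

lemma spectral_form:
  assumes es: "orthonormal_eigensystem n A n u l"
  shows "(\<Sum>a<n. \<Sum>b<n. cnj (z a) * A a b * z b)
    = of_real (\<Sum>i<n. l i * (cmod (\<Sum>a<n. cnj (u i a) * z a))\<^sup>2)"
proof -
  have "(\<Sum>a<n. \<Sum>b<n. cnj (z a) * A a b * z b)
    = (\<Sum>a<n. \<Sum>b<n. \<Sum>i<n. of_real (l i) * ((cnj (z a) * u i a) * (cnj (u i b) * z b)))"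
    by (intro sum.cong refl)
      (simp add: spectral_sum_eigenvalues[OF es] spectral_sum_def sum_distrib_left sum_distrib_right mult_ac)
  also have "\<dots> = (\<Sum>i<n. of_real (l i) * ((\<Sum>a<n. cnj (z a) * u i a) * (\<Sum>b<n. cnj (u i b) * z b)))"
    by (rule trans[OF sum_rotate]) (simp only: sum_distrib_left[symmetric] sum_distrib_right[symmetric])
  also have "\<dots> = (\<Sum>i<n. of_real (l i * (cmod (\<Sum>a<n. cnj (u i a) * z a))\<^sup>2))"
  proof (intro sum.cong refl)
    fix i
    have "(\<Sum>a<n. cnj (z a) * u i a) = cnj (\<Sum>a<n. cnj (u i a) * z a)" by (simp add: mult.commute)
    then show "of_real (l i) * ((\<Sum>a<n. cnj (z a) * u i a) * (\<Sum>b<n. cnj (u i b) * z b))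
      = of_real (l i * (cmod (\<Sum>a<n. cnj (u i a) * z a))\<^sup>2)"
      by (simp only: of_real_mult complex_norm_square mult.commute)
  qed
  finally show ?thesis by simp
qed

text \<open>This is the spectral form of the identity matrix, which has the same \<open>u\<close> as
  an eigensystem with all eigenvalues 1.\<close>

lemma parseval:
  assumes es: "orthonormal_eigensystem n A n u l"
  shows "(\<Sum>i<n. (cmod (\<Sum>a<n. cnj (u i a) * z a))\<^sup>2) = (\<Sum>a<n. (cmod (z a))\<^sup>2)"
proof -
  have "orthonormal_eigensystem n (\<lambda>a b. of_bool (a = b)) n u (\<lambda>_. 1)"
    using orthonormal_eigensystemD(1)[OF es]
    by (auto simp: orthonormal_eigensystem_def sum_of_bool_eq)
  from spectral_form[OF this, of z]
  have "complex_of_real (\<Sum>i<n. (cmod (\<Sum>a<n. cnj (u i a) * z a))\<^sup>2)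
      = (\<Sum>a<n. \<Sum>b<n. cnj (z a) * of_bool (a = b) * z b)" by simp
  also have "\<dots> = (\<Sum>a<n. z a * cnj (z a))"
    by (intro sum.cong refl) (auto simp: mult.assoc sum_distrib_left[symmetric] sum_of_bool_eq)
  finally show ?thesis by (simp only: sum_mult_cnj of_real_eq_iff)
qed

section \<open>Inertia of matrices supported on graphs of girth five\<close>

text \<open>Dimension count in the manner of Sylvester's law. If \<open>A'\<close> had more
  nonnegative eigenvalues than \<open>A\<close>, the image under \<open>d\<close> of the negative
  eigenspace of \<open>A\<close> would be described by more parameters than \<open>A'\<close> has
  negative eigenvalues. A nontrivial combination would then give \<open>z\<close> orthogonal to all
  negative eigenvectors of \<open>A'\<close>, where its form cannot be negative.\<close>

lemma inertia_mono:
  fixes A A' :: "nat \<Rightarrow> nat \<Rightarrow> complex"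
  assumes es: "orthonormal_eigensystem n A n u l" and es': "orthonormal_eigensystem n A' n u' l'"
    and neg: "\<And>c z. (\<And>i. i < n \<Longrightarrow> 0 \<le> l i \<Longrightarrow> c i = 0) \<Longrightarrow> \<exists>i<n. c i \<noteq> 0 \<Longrightarrow>
      (\<And>a. z a = d a * (\<Sum>i<n. c i * u i a)) \<Longrightarrow>
      Re (\<Sum>a<n. \<Sum>b<n. cnj (z a) * A' a b * z b) < 0"
  shows "card {i. i < n \<and> 0 \<le> l' i} \<le> card {i. i < n \<and> 0 \<le> l i}"
proof (rule ccontr)
  let ?P = "{i. i < n \<and> 0 \<le> l i}" and ?P' = "{i. i < n \<and> 0 \<le> l' i}"
  let ?N' = "{i. i < n \<and> l' i < 0}"
  assume "\<not> card ?P' \<le> card ?P"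
  moreover have "card ?P' + card ?N' = n"
  proof -
    have "?P' \<union> ?N' = {..<n}" "?P' \<inter> ?N' = {}" by auto
    then show ?thesis by (metis card_Un_disjoint card_lessThan finite_Un finite_lessThan)
  qed
  ultimately have less: "card (?P <+> ?N') < n" by (subst card_Plus) auto
  \<comment> \<open>Equations for the coefficients \<open>c\<close>: those tagged \<open>Inl\<close>
    remove the nonnegative eigenvectors of \<open>A\<close>, those tagged \<open>Inr\<close> make
    \<open>z\<close> orthogonal to the negative eigenvectors of \<open>A'\<close>.\<close>
  define m where "m j i = (case j of Inl i0 \<Rightarrow> of_bool (i = i0)
      | Inr j0 \<Rightarrow> \<Sum>a<n. cnj (u' j0 a) * (d a * u i a))" for j :: "nat + nat" and i
  have fin: "finite (?P <+> ?N')" by simp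
  obtain c where c: "\<exists>i<n. c i \<noteq> 0" "\<And>j. j \<in> ?P <+> ?N' \<Longrightarrow> (\<Sum>i<n. m j i * c i) = 0"
    by (rule kernel_vector_exists[OF fin less, of m]) blast
  define z where "z a = d a * (\<Sum>i<n. c i * u i a)" for a
  have c0: "c i = 0" if "i < n" "0 \<le> l i" for i
    using c(2)[OF InlI, of i] that by (simp add: m_def sum_of_bool_eq)
  have "(\<Sum>a<n. cnj (u' j a) * z a) = 0" if "j < n" "l' j < 0" for j
  proof -
    have "(\<Sum>a<n. cnj (u' j a) * z a) = (\<Sum>a<n. \<Sum>i<n. cnj (u' j a) * (d a * u i a) * c i)"
      by (simp add: z_def sum_distrib_left mult_ac)
    also have "\<dots> = (\<Sum>i<n. m (Inr j) i * c i)"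
      by (subst sum.swap) (simp add: m_def sum_distrib_right)
    also have "\<dots> = 0" using c(2)[OF InrI, of j] that by simp
    finally show ?thesis .
  qed
  then have "0 \<le> l' j * (cmod (\<Sum>a<n. cnj (u' j a) * z a))\<^sup>2" if "j < n" for j
    using that by (cases "0 \<le> l' j") auto
  then have "0 \<le> Re (\<Sum>a<n. \<Sum>b<n. cnj (z a) * A' a b * z b)"
    unfolding spectral_form[OF es'] by (auto intro!: sum_nonneg)
  moreover have "Re (\<Sum>a<n. \<Sum>b<n. cnj (z a) * A' a b * z b) < 0"
    using c0 c(1) by (rule neg) (simp_all add: z_def)
  ultimately show False by simp
qed

text \<open>The negative eigenvalues of \<open>A\<close> stay a distance \<open>M\<close> away from
  0, so a small multiple of \<open>H\<close> keeps the form negative on their eigenspace. The number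
  \<open>e\<close> is fixed before \<open>d\<close>, because the scaling will later be computed from
  the perturbed matrix.\<close>

lemma inertia_perturbation:
  fixes A H :: "nat \<Rightarrow> nat \<Rightarrow> complex"
  assumes es: "orthonormal_eigensystem n A n u l"
  obtains e :: real where "e > 0"
    "\<And>d u' l'. (\<And>a. a < n \<Longrightarrow> d a > 0) \<Longrightarrow>
       orthonormal_eigensystem n (\<lambda>a b. of_real (d a * d b) * (A a b + of_real e * H a b)) n u' l' \<Longrightarrow>
       card {i. i < n \<and> 0 \<le> l' i} \<le> card {i. i < n \<and> 0 \<le> l i}"
proof -
  define h where "h = (\<Sum>a<n. \<Sum>b<n. cmod (H a b))"
  \<comment> \<open>The inserted 1 covers the case that \<open>A\<close> has no negative
    eigenvalue.\<close>
  define M where "M = Min (insert 1 ((\<lambda>i. - l i) ` {i. i < n \<and> l i < 0}))"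
  have M: "M > 0" unfolding M_def by (subst Min_gr_iff) auto
  have lM: "l i \<le> - M" if "i < n" "l i < 0" for i
  proof -
    have "M \<le> - l i" unfolding M_def using that by (intro Min_le) auto
    then show ?thesis by simp
  qed
  have h: "h \<ge> 0" unfolding h_def by (intro sum_nonneg) auto
  define e where "e = M / (h + 1)"
  have e: "e > 0" and eh: "e * h < M" using M h by (auto simp: e_def field_simps)
  show ?thesis
  proof (rule that[OF e])
    fix d :: "nat \<Rightarrow> real" and u' l'
    assume d: "\<And>a. a < n \<Longrightarrow> d a > 0"
    assume es': "orthonormal_eigensystem n (\<lambda>a b. of_real (d a * d b) * (A a b + of_real e * H a b)) n u' l'"
    show "card {i. i < n \<and> 0 \<le> l' i} \<le> card {i. i < n \<and> 0 \<le> l i}"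
    \<comment> \<open>Dividing by \<open>d\<close> undoes the diagonal congruence: the scaled form
      at \<open>z\<close> is the form of \<open>A + e H\<close> at the unscaled vector
      \<open>y\<close>.\<close>
    proof (rule inertia_mono[OF es es', where d = "\<lambda>a. of_real (1 / d a)"])
      fix c :: "nat \<Rightarrow> complex" and z
      assume c0: "\<And>i. i < n \<Longrightarrow> 0 \<le> l i \<Longrightarrow> c i = 0" and c: "\<exists>i<n. c i \<noteq> 0"
        and z: "\<And>a. z a = of_real (1 / d a) * (\<Sum>i<n. c i * u i a)"
      define y where "y a = (\<Sum>i<n. c i * u i a)" for a
      define N where "N = (\<Sum>i<n. (cmod (c i))\<^sup>2)"
      have N: "N > 0" unfolding N_def using c by (auto intro!: sum_pos2)
      have uy: "(\<Sum>a<n. cnj (u j a) * y a) = c j" if "j < n" for j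
      proof -
        have "(\<Sum>a<n. cnj (u j a) * y a) = (\<Sum>a<n. \<Sum>i<n. c i * (u i a * cnj (u j a)))"
          by (simp add: y_def sum_distrib_left mult_ac)
        also have "\<dots> = (\<Sum>i<n. c i * of_bool (i = j))"
          using that by (subst sum.swap)
            (simp add: sum_distrib_left[symmetric] orthonormal_eigensystemD(1)[OF es])
        finally show ?thesis using that by (simp add: sum_of_bool_eq)
      qed
      have yN: "(\<Sum>a<n. (cmod (y a))\<^sup>2) = N"
        using parseval[OF es, of y] by (simp add: uy N_def)
      have yab: "cmod (y a) * cmod (y b) \<le> N" if "a < n" "b < n" for a b
      proof -
        have "(cmod (y a))\<^sup>2 \<le> N" "(cmod (y b))\<^sup>2 \<le> N"
          unfolding yN[symmetric] using that by (auto intro!: member_le_sum)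
        moreover have "2 * (cmod (y a) * cmod (y b)) \<le> (cmod (y a))\<^sup>2 + (cmod (y b))\<^sup>2"
          using sum_squares_bound[of "cmod (y a)" "cmod (y b)"] by simp
        ultimately show ?thesis by linarith
      qed
      have "(\<Sum>a<n. \<Sum>b<n. cnj (z a) * (of_real (d a * d b) * (A a b + of_real e * H a b)) * z b)
          = (\<Sum>a<n. \<Sum>b<n. cnj (y a) * A a b * y b + of_real e * (cnj (y a) * H a b * y b))"
      proof (intro sum.cong refl)
        fix a b assume "a \<in> {..<n}" "b \<in> {..<n}"
        then have "d a \<noteq> 0" "d b \<noteq> 0" using d[of a] d[of b] by auto
        then show "cnj (z a) * (of_real (d a * d b) * (A a b + of_real e * H a b)) * z b
          = cnj (y a) * A a b * y b + of_real e * (cnj (y a) * H a b * y b)"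
          unfolding z y_def[symmetric] by (simp add: field_simps)
      qed
      also have "\<dots> = (\<Sum>a<n. \<Sum>b<n. cnj (y a) * A a b * y b)
          + of_real e * (\<Sum>a<n. \<Sum>b<n. cnj (y a) * H a b * y b)"
        by (simp add: sum.distrib sum_distrib_left)
      finally have "Re (\<Sum>a<n. \<Sum>b<n. cnj (z a) * (of_real (d a * d b) * (A a b + of_real e * H a b)) * z b)
        = Re (\<Sum>a<n. \<Sum>b<n. cnj (y a) * A a b * y b) + e * Re (\<Sum>a<n. \<Sum>b<n. cnj (y a) * H a b * y b)"
        by simp
      also have "Re (\<Sum>a<n. \<Sum>b<n. cnj (y a) * A a b * y b) = (\<Sum>i<n. l i * (cmod (c i))\<^sup>2)"
        unfolding spectral_form[OF es] by (simp add: uy)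
      also have "\<dots> \<le> (\<Sum>i<n. - M * (cmod (c i))\<^sup>2)"
      proof (intro sum_mono)
        fix i assume "i \<in> {..<n}"
        then show "l i * (cmod (c i))\<^sup>2 \<le> - M * (cmod (c i))\<^sup>2"
          using c0[of i] mult_right_mono[OF lM[of i], of "(cmod (c i))\<^sup>2"]
          by (cases "0 \<le> l i") auto
      qed
      also have "\<dots> = - M * N" by (simp add: N_def sum_distrib_left)
      also have "Re (\<Sum>a<n. \<Sum>b<n. cnj (y a) * H a b * y b) \<le> h * N"
      proof -
        have "Re (\<Sum>a<n. \<Sum>b<n. cnj (y a) * H a b * y b) \<le> cmod (\<Sum>a<n. \<Sum>b<n. cnj (y a) * H a b * y b)"
          by (rule complex_Re_le_cmod)
        also have "\<dots> \<le> (\<Sum>a<n. \<Sum>b<n. cmod (H a b) * (cmod (y a) * cmod (y b)))"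
          by (intro order_trans[OF norm_sum] sum_mono) (simp add: norm_mult mult_ac)
        also have "\<dots> \<le> (\<Sum>a<n. \<Sum>b<n. cmod (H a b) * N)"
          using yab by (intro sum_mono mult_left_mono) auto
        finally show ?thesis by (simp add: h_def sum_distrib_right)
      qed
      then have "- M * N + e * Re (\<Sum>a<n. \<Sum>b<n. cnj (y a) * H a b * y b) \<le> (e * h - M) * N"
        using e by (simp add: algebra_simps)
      also have "\<dots> < 0" using eh N by (simp add: mult_neg_pos)
      finally show "Re (\<Sum>a<n. \<Sum>b<n. cnj (z a) * (of_real (d a * d b) * (A a b + of_real e * H a b)) * z b) < 0"
        by simp
    qed
  qed
qed

section \<open>Symmetric diagonal scaling by a convex potential\<close>

lemma exp_minus_linear_bounded_below:
  fixes b c :: real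
  assumes "b \<ge> 0" "c \<ge> 0" "c > 0 \<Longrightarrow> b > 0"
  shows "\<exists>m. \<forall>y. m \<le> b * exp y - c * y"
proof (cases "c = 0")
  case False
  then have c: "c > 0" and b: "b > 0" using assms by auto
  have "c + c * ln (b / c) \<le> b * exp y - c * y" for y
  proof -
    \<comment> \<open>The tangent estimate \<open>1 + x <= exp x\<close>, shifted to the minimizer
      \<open>y = - ln (b / c)\<close> of the function.\<close>
    have "c * (1 + (y + ln (b / c))) \<le> c * exp (y + ln (b / c))"
      using c by (intro mult_left_mono exp_ge_add_one_self) auto
    also have "\<dots> = b * exp y" using b c by (simp add: exp_add)
    finally show ?thesis by (simp add: algebra_simps)
  qed
  then show ?thesis by blast
qed (use assms in \<open>auto intro!: exI[of _ 0]\<close>)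

text \<open>Only row \<open>i\<close> and column \<open>i\<close> change; by symmetry they
  contribute equally, and the unchanged diagonal entry is not counted twice.\<close>

lemma sum_coordinate_change:
  fixes f g :: "'a \<Rightarrow> 'a \<Rightarrow> real"
  assumes "finite I" "i \<in> I"
    and eq: "\<And>a b. a \<in> I \<Longrightarrow> b \<in> I \<Longrightarrow> a \<noteq> i \<Longrightarrow> b \<noteq> i \<Longrightarrow> g a b = f a b"
    and diag: "g i i = f i i"
    and sym: "\<And>a. a \<in> I \<Longrightarrow> g a i = g i a" "\<And>a. a \<in> I \<Longrightarrow> f a i = f i a"
  shows "(\<Sum>a\<in>I. \<Sum>b\<in>I. g a b) - (\<Sum>a\<in>I. \<Sum>b\<in>I. f a b) = 2 * (\<Sum>b\<in>I. g i b - f i b)"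
proof -
  define h where "h a b = g a b - f a b" for a b
  have "(\<Sum>a\<in>I. \<Sum>b\<in>I. g a b) - (\<Sum>a\<in>I. \<Sum>b\<in>I. f a b) = (\<Sum>a\<in>I. \<Sum>b\<in>I. h a b)"
    by (simp add: h_def sum_subtractf)
  also have "\<dots> = (\<Sum>b\<in>I. h i b) + (\<Sum>a\<in>I-{i}. \<Sum>b\<in>I. h a b)"
    using assms(1,2) by (rule sum.remove)
  also have "(\<Sum>a\<in>I-{i}. \<Sum>b\<in>I. h a b) = (\<Sum>a\<in>I-{i}. h i a)"
  proof (intro sum.cong refl)
    fix a assume a: "a \<in> I - {i}"
    have "(\<Sum>b\<in>I. h a b) = h a i + (\<Sum>b\<in>I-{i}. h a b)"
      using assms(1,2) by (rule sum.remove)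
    also have "(\<Sum>b\<in>I-{i}. h a b) = 0"
      using a eq by (intro sum.neutral) (auto simp: h_def)
    finally show "(\<Sum>b\<in>I. h a b) = h i a" using a sym by (simp add: h_def)
  qed
  also have "\<dots> = (\<Sum>b\<in>I. h i b)"
    using diag by (simp add: sum.remove[OF assms(1,2)] h_def)
  finally show ?thesis by (simp add: h_def)
qed

text \<open>Hypothesis \<open>D\<close> says that moving one coordinate by \<open>x\<close> lowers
  the potential by at most \<open>2 * t^2\<close>; \<open>r\<close> is the current row sum and
  \<open>s\<close> the target. A second-order expansion of \<open>exp\<close> at the two moves
  \<open>x = t\<close> and \<open>x = - t\<close> bounds the derivative \<open>2 * (r - s)\<close>
  from both sides.\<close>

lemma abs_diff_le_of_exp_change:
  fixes r s t :: real
  assumes r: "0 \<le> r" "0 \<le> s" and t: "0 < t" "t \<le> 1"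
    and D: "\<And>x. - (2 * t\<^sup>2) \<le> 2 * r * (exp x - 1) - 2 * s * x"
  shows "\<bar>r - s\<bar> \<le> (2 * s + 3) * t"
proof -
  have t2: "t\<^sup>2 \<le> 1" using t by (simp add: power_le_one)
  \<comment> \<open>The move \<open>x = -1\<close> gives the a priori bound
    \<open>r <= 2 * s + 2\<close>, which frees the quadratic error term of \<open>r\<close>.\<close>
  have "exp (-1) \<le> (1/2 :: real)"
    using exp_ge_add_one_self[of 1] by (simp add: exp_minus field_simps)
  then have "2 * r * (exp (-1) - 1) \<le> 2 * r * (-1/2)"
    using r by (intro mult_left_mono) auto
  then have r2: "r \<le> 2 * s + 2" using D[of "-1"] t2 by simp
  have ex: "exp x - 1 \<le> x + x\<^sup>2" if "\<bar>x\<bar> \<le> 1" for x :: real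
  proof (cases "x \<ge> 0")
    case True then show ?thesis using exp_bound[of x] that by simp
  next
    case False
    have "exp x * (1 - x) \<le> exp x * exp (- x)"
      using exp_ge_add_one_self[of "- x"] by (intro mult_left_mono) auto
    then have "exp x * (1 - x) \<le> 1" by (simp add: exp_minus)
    also have "\<dots> \<le> (1 + x + x\<^sup>2) * (1 - x)"
    proof -
      have "x * x\<^sup>2 \<le> 0" using False by (intro mult_nonpos_nonneg) auto
      then show ?thesis by (simp add: power2_eq_square algebra_simps)
    qed
    finally have "exp x \<le> 1 + x + x\<^sup>2" using False by simp
    then show ?thesis by simp
  qed
  have *: "- (2 * t\<^sup>2) \<le> 2 * r * (x + x\<^sup>2) - 2 * s * x" if "\<bar>x\<bar> \<le> 1" for x
  proof -
    have "2 * r * (exp x - 1) \<le> 2 * r * (x + x\<^sup>2)"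
      using ex[OF that] r by (intro mult_left_mono) auto
    then show ?thesis using D[of x] by linarith
  qed
  have "t * (s - r) \<le> t * ((2 * s + 3) * t)"
  proof -
    have "t * (s - r) \<le> t\<^sup>2 * (1 + r)" using *[of t] t by (simp add: algebra_simps)
    also have "\<dots> \<le> t\<^sup>2 * (2 * s + 3)" using r2 by (intro mult_left_mono) auto
    finally show ?thesis by (simp add: power2_eq_square algebra_simps)
  qed
  moreover have "t * (r - s) \<le> t * ((2 * s + 3) * t)"
  proof -
    have "t * (r - s) \<le> t\<^sup>2 * (1 + r)" using *[of "- t"] t by (simp add: algebra_simps)
    also have "\<dots> \<le> t\<^sup>2 * (2 * s + 3)" using r2 by (intro mult_left_mono) auto
    finally show ?thesis by (simp add: power2_eq_square algebra_simps)
  qed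
  ultimately show ?thesis using t by (simp add: abs_le_iff)
qed

text \<open>
  The scaling exponents are a near-minimizer of a convex potential that is bounded below because
  \<open>C\<close> has smaller support than \<open>B\<close>.  Its near-minimality in each coordinate direction already
  forces the row sums to be close to those of \<open>C\<close>, so no minimizer is needed.
\<close>

lemma approximate_symmetric_scaling:
  fixes B C :: "'a \<Rightarrow> 'a \<Rightarrow> real"
  assumes I: "finite I"
    and B: "\<And>a b. a \<in> I \<Longrightarrow> b \<in> I \<Longrightarrow> 0 \<le> B a b" "\<And>a b. a \<in> I \<Longrightarrow> b \<in> I \<Longrightarrow> B a b = B b a"
      "\<And>a. a \<in> I \<Longrightarrow> B a a = 0"
    and C: "\<And>a b. a \<in> I \<Longrightarrow> b \<in> I \<Longrightarrow> 0 \<le> C a b" "\<And>a b. a \<in> I \<Longrightarrow> b \<in> I \<Longrightarrow> C a b = C b a"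
      "\<And>a. a \<in> I \<Longrightarrow> (\<Sum>b\<in>I. C a b) = s"
    and supp: "\<And>a b. a \<in> I \<Longrightarrow> b \<in> I \<Longrightarrow> C a b > 0 \<Longrightarrow> B a b > 0"
    and e: "e > 0" and s: "s \<ge> 0"
  obtains d where "\<And>a. d a > 0" "\<And>a. a \<in> I \<Longrightarrow> \<bar>(\<Sum>b\<in>I. d a * B a b * d b) - s\<bar> \<le> e"
proof -
  \<comment> \<open>With \<open>C\<close> having row sums \<open>s\<close>, the derivative of
    \<open>F\<close> in coordinate \<open>i\<close> is twice the scaled row sum of \<open>B\<close>
    minus \<open>2 * s\<close>, so critical points are exact scalings.\<close>
  define f where "f x a b = B a b * exp (x a + x b) - C a b * (x a + x b)" for x a b
  define F where "F x = (\<Sum>a\<in>I. \<Sum>b\<in>I. f x a b)" for x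
  have "\<exists>m. \<forall>y. m \<le> B a b * exp y - C a b * y" if "a \<in> I" "b \<in> I" for a b
    using that by (intro exp_minus_linear_bounded_below B C supp)
  then obtain m where m: "m a b \<le> B a b * exp y - C a b * y" if "a \<in> I" "b \<in> I" for a b y by metis
  have "(\<Sum>a\<in>I. \<Sum>b\<in>I. m a b) \<le> F x" for x
    unfolding F_def f_def by (intro sum_mono m)
  then have bdd: "bdd_below (range F)" by (intro bdd_belowI2)
  \<comment> \<open>The cap 1 is the range in which the expansion of \<open>exp\<close> is valid;
    the quotient makes the final error at most \<open>e\<close>.\<close>
  define t where "t = min 1 (e / (2 * s + 3))"
  have t: "0 < t" "t \<le> 1" using e s by (auto simp: t_def)
  have "t \<le> e / (2 * s + 3)" by (simp add: t_def)
  then have t': "(2 * s + 3) * t \<le> e" using s by (simp add: pos_le_divide_eq mult.commute)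
  have "Inf (range F) < Inf (range F) + 2 * t\<^sup>2" using t by simp
  then obtain x where x: "F x < Inf (range F) + 2 * t\<^sup>2"
    using cInf_lessD[of "range F" "Inf (range F) + 2 * t\<^sup>2"] by blast
  have near: "F x \<le> F y + 2 * t\<^sup>2" for y
    using x cInf_lower[OF _ bdd, of "F y"] by auto
  show ?thesis
  proof (rule that[of "\<lambda>a. exp (x a)"])
    fix i assume i: "i \<in> I"
    define r where "r = (\<Sum>b\<in>I. exp (x i) * B i b * exp (x b))"
    have "\<not> 0 < C i i" using supp[OF i i] B(3)[OF i] by auto
    then have C0: "C i i = 0" using C(1)[OF i i] by simp
    have D: "- (2 * t\<^sup>2) \<le> 2 * r * (exp z - 1) - 2 * s * z" for z
    proof -
      define y where "y = x(i := x i + z)"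
      have "F y - F x = 2 * (\<Sum>b\<in>I. f y i b - f x i b)"
        unfolding F_def using I i
      proof (rule sum_coordinate_change)
        show "f y i i = f x i i" using B(3)[OF i] C0 by (simp add: f_def)
      qed (use B(2) C(2) i in \<open>auto simp: f_def y_def add.commute\<close>)
      also have "(\<Sum>b\<in>I. f y i b - f x i b)
          = (\<Sum>b\<in>I. (exp (x i) * B i b * exp (x b)) * (exp z - 1) - C i b * z)"
      proof (intro sum.cong refl)
        fix b assume "b \<in> I"
        show "f y i b - f x i b = (exp (x i) * B i b * exp (x b)) * (exp z - 1) - C i b * z"
          using B(3)[OF i] C0
          by (cases "b = i") (simp_all add: f_def y_def exp_add algebra_simps)
      qed
      also have "\<dots> = r * (exp z - 1) - s * z"
        unfolding sum_subtractf r_def C(3)[OF i, symmetric] by (simp only: sum_distrib_right)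
      finally show ?thesis using near[of y] by simp
    qed
    have "0 \<le> r" unfolding r_def using B(1) i by (intro sum_nonneg) auto
    then have "\<bar>r - s\<bar> \<le> (2 * s + 3) * t" by (rule abs_diff_le_of_exp_change) (use s t D in auto)
    then show "\<bar>(\<Sum>b\<in>I. exp (x i) * B i b * exp (x b)) - s\<bar> \<le> e"
      using t' unfolding r_def by linarith
  qed simp
qed

section \<open>Moments of the eigenvalues under the absence of short cycles\<close>

text \<open>The quartic touches the bound 32 at \<open>z = 2\<close> and the bound 0 at
  \<open>z = -2\<close>. On each half-line its gap is a square times a factor of constant
  sign.\<close>

lemma quartic_le_indicator:
  fixes z :: real
  shows "12 * z + 8 * z\<^sup>2 - z ^ 3 - z ^ 4 \<le> 32 * of_bool (0 \<le> z)"
proof (cases "0 \<le> z")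
  case True
  have "32 - (12 * z + 8 * z\<^sup>2 - z ^ 3 - z ^ 4) = (z - 2)\<^sup>2 * (z\<^sup>2 + 5 * z + 8)"
    by (simp add: power2_eq_square power3_eq_cube power4_eq_xxxx algebra_simps)
  also have "\<dots> \<ge> 0" using True by (intro mult_nonneg_nonneg add_nonneg_nonneg) auto
  finally show ?thesis using True by simp
next
  case False
  have "12 * z + 8 * z\<^sup>2 - z ^ 3 - z ^ 4 = z * ((z + 2)\<^sup>2 * (3 - z))"
    by (simp add: power2_eq_square power3_eq_cube power4_eq_xxxx algebra_simps)
  also have "\<dots> \<le> 0" using False by (intro mult_nonpos_nonneg mult_nonneg_nonneg) auto
  finally show ?thesis using False by simp
qed

text \<open>With a single nonzero term there are no cross terms. The sum will run over the walks of
  length two between distinct vertices, which have at most one common neighbour.\<close>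

lemma cmod_sum_at_most_one:
  assumes "finite S" "\<And>c d. c \<in> S \<Longrightarrow> d \<in> S \<Longrightarrow> f c \<noteq> 0 \<Longrightarrow> f d \<noteq> 0 \<Longrightarrow> c = d"
  shows "(cmod (\<Sum>c\<in>S. f c))\<^sup>2 = (\<Sum>c\<in>S. (cmod (f c))\<^sup>2)"
proof (cases "\<exists>c\<in>S. f c \<noteq> 0")
  case True
  then obtain c where c: "c \<in> S" "f c \<noteq> 0" by blast
  then have "f d = 0" if "d \<in> S - {c}" for d using assms(2) that by blast
  then show ?thesis by (simp add: sum.remove[OF assms(1) c(1)])
qed simp

text \<open>
  In a graph without triangles and four-cycles, the only closed walks of length at most four are
  the degenerate ones, so the first four moments are determined by the row norms.
\<close>

lemma girth_five_nonneg_eigenvalues: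
  fixes A :: "nat \<Rightarrow> nat \<Rightarrow> complex"
  assumes herm: "\<And>a b. a < n \<Longrightarrow> b < n \<Longrightarrow> A b a = cnj (A a b)"
    and supp: "\<And>a b. a < n \<Longrightarrow> b < n \<Longrightarrow> A a b \<noteq> 0 \<Longrightarrow> E a b"
    and loopless: "\<And>a. a < n \<Longrightarrow> \<not> E a a"
    and C3: "\<And>a b c. a < n \<Longrightarrow> b < n \<Longrightarrow> c < n \<Longrightarrow> E a b \<Longrightarrow> E b c \<Longrightarrow> \<not> E c a"
    and C4: "\<And>a b c d. a < n \<Longrightarrow> b < n \<Longrightarrow> c < n \<Longrightarrow> d < n \<Longrightarrow> a \<noteq> b \<Longrightarrow>
      E a c \<Longrightarrow> E c b \<Longrightarrow> E a d \<Longrightarrow> E d b \<Longrightarrow> c = d"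
    and es: "orthonormal_eigensystem n A n u l"
    and r: "\<And>a. r a = (\<Sum>b<n. (cmod (A a b))\<^sup>2)"
  shows "(\<Sum>a<n. 8 * r a - 2 * (r a)\<^sup>2) \<le> 32 * card {i. i < n \<and> 0 \<le> l i}"
proof -
  note A_eq = spectral_sum_eigenvalues[OF es]
  define S where "S a b = (\<Sum>c<n. A a c * A c b)" for a b
  have S_eq: "S a b = spectral_sum n u (\<lambda>i. l i * l i) a b" if "a < n" "b < n" for a b
    using that by (simp add: S_def A_eq spectral_sum_mult[OF es])
  have AA: "A a b * A b a = of_real ((cmod (A a b))\<^sup>2)" if "a < n" "b < n" for a b
    unfolding herm[OF that] complex_norm_square ..
  have S_diag: "S a a = of_real (r a)" if "a < n" for a
    using that by (simp add: S_def r AA del: of_real_power)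
  have m1: "(\<Sum>i<n. l i) = 0"
  proof -
    have "of_real (\<Sum>i<n. l i) = (\<Sum>a<n. A a a)"
      unfolding spectral_sum_trace[OF es, symmetric] by (simp add: A_eq)
    also have "\<dots> = 0" using supp loopless by (intro sum.neutral) auto
    finally show ?thesis by (simp only: of_real_eq_0_iff)
  qed
  have m2: "(\<Sum>i<n. (l i)\<^sup>2) = (\<Sum>a<n. r a)"
  proof -
    have "of_real (\<Sum>i<n. l i * l i) = (\<Sum>a<n. S a a)"
      unfolding spectral_sum_trace[OF es, symmetric] by (simp add: S_eq)
    also have "\<dots> = of_real (\<Sum>a<n. r a)" by (simp add: S_diag)
    finally show ?thesis by (simp only: of_real_eq_iff power2_eq_square)
  qed
  have m3: "(\<Sum>i<n. (l i) ^ 3) = 0"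
  proof -
    have "of_real (\<Sum>i<n. l i * l i * l i) = (\<Sum>a<n. \<Sum>b<n. S a b * A b a)"
      unfolding spectral_sum_trace[OF es, symmetric] spectral_sum_mult[OF es, symmetric]
      by (simp add: S_eq A_eq spectral_sum_mult[OF es])
    also have "\<dots> = 0"
      unfolding S_def sum_distrib_right
    proof (intro sum.neutral ballI)
      fix a b c assume "a \<in> {..<n}" "b \<in> {..<n}" "c \<in> {..<n}"
      then show "A a c * A c b * A b a = 0"
        using supp[of a c] supp[of c b] supp[of b a] C3[of a c b] by auto
    qed
    finally show ?thesis by (simp only: of_real_eq_0_iff power3_eq_cube)
  qed
  have hermS: "S b a = cnj (S a b)" if "a < n" "b < n" for a b
    using that by (simp add: S_eq spectral_sum_def mult.commute)
  have S_off: "(cmod (S a b))\<^sup>2 = (\<Sum>c<n. (cmod (A a c))\<^sup>2 * (cmod (A b c))\<^sup>2)"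
    if "a < n" "b < n" "a \<noteq> b" for a b
  proof -
    have "(cmod (S a b))\<^sup>2 = (\<Sum>c<n. (cmod (A a c * A c b))\<^sup>2)"
      unfolding S_def
    proof (rule cmod_sum_at_most_one)
      fix c d assume "c \<in> {..<n}" "d \<in> {..<n}" "A a c * A c b \<noteq> 0" "A a d * A d b \<noteq> 0"
      then show "c = d" using C4[of a b c d] supp[of a c] supp[of c b] supp[of a d] supp[of d b] that by auto
    qed simp
    also have "\<dots> = (\<Sum>c<n. (cmod (A a c))\<^sup>2 * (cmod (A b c))\<^sup>2)"
      using herm[OF that(2)] by (intro sum.cong refl) (simp add: norm_mult power_mult_distrib)
    finally show ?thesis .
  qed
  have m4: "(\<Sum>i<n. (l i) ^ 4) \<le> (\<Sum>a<n. 2 * (r a)\<^sup>2)"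
  proof -
    have "of_real (\<Sum>i<n. (l i * l i) * (l i * l i)) = (\<Sum>a<n. \<Sum>b<n. S a b * S b a)"
      unfolding spectral_sum_trace[OF es, symmetric] spectral_sum_mult[OF es, symmetric]
      by (simp add: S_eq spectral_sum_mult[OF es])
    also have "\<dots> = of_real (\<Sum>a<n. \<Sum>b<n. (cmod (S a b))\<^sup>2)"
      unfolding of_real_sum
    proof (intro sum.cong refl)
      fix a b assume "a \<in> {..<n}" "b \<in> {..<n}"
      then show "S a b * S b a = of_real ((cmod (S a b))\<^sup>2)"
        using hermS[of a b] by (simp only: lessThan_iff complex_norm_square)
    qed
    finally have "(\<Sum>i<n. (l i) ^ 4) = (\<Sum>a<n. \<Sum>b<n. (cmod (S a b))\<^sup>2)"
      by (simp only: of_real_eq_iff power4_eq_xxxx mult.assoc)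
    \<comment> \<open>The off-diagonal sum is enlarged to all pairs, including \<open>a = b\<close>,
      so that it factors. Diagonal and enlarged sum contribute the squared row norms once each,
      which explains the factor 2.\<close>
    also have "\<dots> \<le> (\<Sum>a<n. \<Sum>b<n. (r a)\<^sup>2 * of_bool (a = b)
        + (\<Sum>c<n. (cmod (A a c))\<^sup>2 * (cmod (A b c))\<^sup>2))"
    proof (intro sum_mono)
      fix a b assume "a \<in> {..<n}" "b \<in> {..<n}"
      then show "(cmod (S a b))\<^sup>2 \<le> (r a)\<^sup>2 * of_bool (a = b)
        + (\<Sum>c<n. (cmod (A a c))\<^sup>2 * (cmod (A b c))\<^sup>2)"
        using S_off[of a b] S_diag[of a] by (cases "a = b") (auto intro!: sum_nonneg)
    qed
    also have "\<dots> = (\<Sum>a<n. (r a)\<^sup>2) + (\<Sum>c<n. \<Sum>a<n. \<Sum>b<n. (cmod (A a c))\<^sup>2 * (cmod (A b c))\<^sup>2)"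
      unfolding sum.distrib by (intro arg_cong2[where f = "(+)"] sum_rotate) (simp add: sum_of_bool_eq)
    also have "(\<Sum>c<n. \<Sum>a<n. \<Sum>b<n. (cmod (A a c))\<^sup>2 * (cmod (A b c))\<^sup>2)
        = (\<Sum>c<n. (\<Sum>a<n. (cmod (A a c))\<^sup>2)\<^sup>2)"
      by (simp only: power2_eq_square[of "sum _ _"] sum_product)
    also have "\<dots> = (\<Sum>c<n. (r c)\<^sup>2)"
    proof (intro sum.cong refl arg_cong[where f = "\<lambda>x. x\<^sup>2"])
      fix c assume "c \<in> {..<n}"
      then have "cmod (A a c) = cmod (A c a)" if "a < n" for a using herm[of c a] that by simp
      then show "(\<Sum>a<n. (cmod (A a c))\<^sup>2) = r c"
        unfolding r by (intro sum.cong refl) simp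
    qed
    finally show ?thesis by (simp add: sum_distrib_left[symmetric])
  qed
  have "(\<Sum>a<n. 8 * r a - 2 * (r a)\<^sup>2) \<le> (\<Sum>i<n. 12 * l i + 8 * (l i)\<^sup>2 - l i ^ 3 - l i ^ 4)"
    using m1 m2 m3 m4
    by (simp add: sum_subtractf sum.distrib sum_distrib_left[symmetric])
  also have "\<dots> \<le> (\<Sum>i<n. 32 * of_bool (0 \<le> l i))"
    by (intro sum_mono quartic_le_indicator)
  also have "\<dots> = 32 * card {i. i < n \<and> 0 \<le> l i}"
    by (simp add: sum_distrib_left[symmetric] Int_def conj_commute)
  finally show ?thesis .
qed

text \<open>Row norms equal to 2 would give \<open>8 * n <= 32 * card\<close> directly. With
  approximate norms the left side drops by less than 8, and integrality of the cardinality restores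
  the exact bound.\<close>

theorem girth_five_inertia:
  fixes A :: "nat \<Rightarrow> nat \<Rightarrow> complex" and E :: "nat \<Rightarrow> nat \<Rightarrow> bool"
  assumes herm: "\<And>a b. a < n \<Longrightarrow> b < n \<Longrightarrow> A b a = cnj (A a b)"
    and supp: "\<And>a b. a < n \<Longrightarrow> b < n \<Longrightarrow> A a b \<noteq> 0 \<Longrightarrow> E a b"
    and sym: "\<And>a b. E a b \<Longrightarrow> E b a"
    and loopless: "\<And>a. a < n \<Longrightarrow> \<not> E a a"
    and C3: "\<And>a b c. a < n \<Longrightarrow> b < n \<Longrightarrow> c < n \<Longrightarrow> E a b \<Longrightarrow> E b c \<Longrightarrow> \<not> E c a"
    and C4: "\<And>a b c d. a < n \<Longrightarrow> b < n \<Longrightarrow> c < n \<Longrightarrow> d < n \<Longrightarrow> a \<noteq> b \<Longrightarrow>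
      E a c \<Longrightarrow> E c b \<Longrightarrow> E a d \<Longrightarrow> E d b \<Longrightarrow> c = d"
    and regular: "\<And>a. a < n \<Longrightarrow> card {b. b < n \<and> E a b} = k" and k: "k > 0"
    and es: "orthonormal_eigensystem n A n u l"
  shows "n \<le> 4 * card {i. i < n \<and> 0 \<le> l i}"
proof -
  \<comment> \<open>\<open>H\<close> is supported on the edges where \<open>A\<close> vanishes, so
    \<open>A + e H\<close> is nonzero exactly on the edges for every \<open>e > 0\<close>.\<close>
  define H :: "nat \<Rightarrow> nat \<Rightarrow> complex" where "H a b = of_bool (E a b \<and> A a b = 0)" for a b
  obtain e :: real where e: "e > 0" and pert:
    "\<And>d u' l'. (\<And>a. a < n \<Longrightarrow> d a > 0) \<Longrightarrow>
       orthonormal_eigensystem n (\<lambda>a b. of_real (d a * d b) * (A a b + of_real e * H a b)) n u' l' \<Longrightarrow>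
       card {i. i < n \<and> 0 \<le> l' i} \<le> card {i. i < n \<and> 0 \<le> l i}"
    by (rule inertia_perturbation[OF es, of H]) blast
  define A1 where "A1 a b = A a b + of_real e * H a b" for a b
  have A1_0: "A1 a b \<noteq> 0 \<longleftrightarrow> E a b" if "a < n" "b < n" for a b
    using supp[OF that] e by (auto simp: A1_def H_def)
  have sym': "E a b = E b a" for a b using sym by blast
  have hermA1: "A1 b a = cnj (A1 a b)" if "a < n" "b < n" for a b
    using herm[OF that] by (simp add: A1_def H_def sym'[of b a])
  define B where "B a b = (cmod (A1 a b))\<^sup>2" for a b
  \<comment> \<open>Regularity enters here: equal weights on the edges form a symmetric matrix with
    all row sums 2 and the same support as \<open>B\<close>.\<close>
  define C where "C a b = 2 / real k * of_bool (E a b)" for a b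
  \<comment> \<open>Chosen so that \<open>n * eta < 1\<close>, while \<open>eta <= 1\<close> makes
    each squared deviation at most \<open>eta\<close>.\<close>
  define eta where "eta = 1 / (real n + 1)"
  obtain d where d: "\<And>a. d a > 0" "\<And>a. a \<in> {..<n} \<Longrightarrow> \<bar>(\<Sum>b<n. d a * B a b * d b) - 2\<bar> \<le> eta"
  proof (rule approximate_symmetric_scaling[where I = "{..<n}" and B = B and C = C and s = 2 and e = eta])
    fix a assume a: "a \<in> {..<n}"
    show "B a a = 0" using A1_0[of a a] loopless[of a] a by (auto simp: B_def)
    have "(\<Sum>b<n. C a b) = 2 / real k * card ({..<n} \<inter> {b. E a b})"
      unfolding C_def sum_distrib_left[symmetric] by simp
    also have "{..<n} \<inter> {b. E a b} = {b. b < n \<and> E a b}" by auto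
    finally show "(\<Sum>b<n. C a b) = 2" using regular[of a] a k by simp
  next
    fix a b assume ab: "a \<in> {..<n}" "b \<in> {..<n}"
    show "B a b = B b a" using hermA1[of a b] ab by (simp add: B_def)
    show "C a b = C b a" by (simp add: C_def sym'[of a b])
    show "B a b > 0" if "C a b > 0"
      using that ab A1_0[of a b] by (auto simp: B_def C_def split: if_splits)
  qed (auto simp: B_def C_def eta_def)
  \<comment> \<open>\<open>B\<close> holds squared moduli, so scaling it by \<open>d\<close> amounts
    to scaling \<open>A1\<close> by the square roots.\<close>
  define X where "X a b = of_real (sqrt (d a) * sqrt (d b)) * A1 a b" for a b
  have hermX: "X b a = cnj (X a b)" if "a < n" "b < n" for a b
    using hermA1[OF that] by (simp add: X_def)
  obtain u' l' where esX: "orthonormal_eigensystem n X n u' l'"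
    using hermitian_spectral_theorem[of n X] hermX by blast
  define r where "r a = (\<Sum>b<n. (cmod (X a b))\<^sup>2)" for a
  have r: "\<bar>r a - 2\<bar> \<le> eta" if "a < n" for a
  proof -
    have "r a = (\<Sum>b<n. d a * B a b * d b)"
      unfolding r_def
    proof (intro sum.cong refl)
      fix b
      show "(cmod (X a b))\<^sup>2 = d a * B a b * d b"
        using d(1)[of a] d(1)[of b] by (simp add: X_def B_def norm_mult power_mult_distrib)
    qed
    then show ?thesis using d(2) that by simp
  qed
  have suppX: "E a b" if "a < n" "b < n" "X a b \<noteq> 0" for a b
    using that A1_0 by (auto simp: X_def)
  have "8 * real n - 8 < (\<Sum>a<n. 8 * r a - 2 * (r a)\<^sup>2)"
  proof -
    have "(\<Sum>a<n. 8 - 2 * eta) \<le> (\<Sum>a<n. 8 * r a - 2 * (r a)\<^sup>2)"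
    proof (intro sum_mono)
      fix a assume "a \<in> {..<n}"
      then have "\<bar>r a - 2\<bar> \<le> eta" by (intro r) simp
      moreover have "eta \<le> 1" by (simp add: eta_def)
      ultimately have "(r a - 2)\<^sup>2 \<le> eta"
        using mult_mono[of "\<bar>r a - 2\<bar>" eta "\<bar>r a - 2\<bar>" 1] by (simp add: power2_eq_square)
      then show "8 - 2 * eta \<le> 8 * r a - 2 * (r a)\<^sup>2"
        by (simp add: power2_eq_square algebra_simps)
    qed
    moreover have "real n * eta < 1" by (simp add: eta_def)
    ultimately show ?thesis by (simp add: algebra_simps)
  qed
  also have "\<dots> \<le> 32 * card {i. i < n \<and> 0 \<le> l' i}"
    by (rule girth_five_nonneg_eigenvalues[OF hermX suppX loopless C3 C4 esX r_def])
  finally have "n \<le> 4 * card {i. i < n \<and> 0 \<le> l' i}" by linarith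
  also have "card {i. i < n \<and> 0 \<le> l' i} \<le> card {i. i < n \<and> 0 \<le> l i}"
  proof (rule pert)
    show "orthonormal_eigensystem n (\<lambda>a b. of_real (sqrt (d a) * sqrt (d b)) * (A a b + of_real e * H a b)) n u' l'"
      using esX by (simp only: X_def[abs_def] A1_def)
  qed (simp add: d(1))
  finally show ?thesis by simp
qed

section \<open>Quantum independence number and the ratio bound\<close>

text \<open>The hypothesis \<open>common\<close> is the identity \<open>k I + J - K\<close> for the
  Gram matrix of the rows of \<open>M\<close>. Instead of passing through eigenvectors, the proof
  expands the sum of squares of \<open>w + sqrt k * v - S / k\<close>, where \<open>w\<close> is the
  transpose of \<open>M\<close> applied to \<open>v\<close>. The constant \<open>S / k\<close>
  cancels the contribution of \<open>J\<close>.\<close>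

lemma common_neighbour_form_bound:
  fixes M :: "'a \<Rightarrow> 'a \<Rightarrow> real" and q :: "'a \<Rightarrow> 'b" and v :: "'a \<Rightarrow> real"
  assumes X: "finite X" "real (card X) = k\<^sup>2" and k: "k > 0"
    and row: "\<And>x. x \<in> X \<Longrightarrow> (\<Sum>y\<in>X. M x y) = k"
    and common: "\<And>x y. x \<in> X \<Longrightarrow> y \<in> X \<Longrightarrow>
      (\<Sum>z\<in>X. M x z * M y z) = k * of_bool (x = y) + 1 - of_bool (q x = q y)"
  shows "- sqrt k * (\<Sum>x\<in>X. (v x)\<^sup>2) \<le> (\<Sum>x\<in>X. \<Sum>y\<in>X. v x * M x y * v y)"
proof -
  define w where "w z = (\<Sum>x\<in>X. M x z * v x)" for z
  define S where "S = (\<Sum>x\<in>X. v x)"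
  define N where "N = (\<Sum>x\<in>X. (v x)\<^sup>2)"
  define Q where "Q = (\<Sum>x\<in>X. \<Sum>y\<in>X. v x * M x y * v y)"
  define K where "K = (\<Sum>x\<in>X. \<Sum>y\<in>X. v x * v y * of_bool (q x = q y))"
  have wv: "(\<Sum>z\<in>X. w z * v z) = Q"
    unfolding w_def Q_def sum_distrib_right
    by (subst sum.swap) (simp add: mult_ac)
  have w1: "(\<Sum>z\<in>X. w z) = k * S"
  proof -
    have "(\<Sum>z\<in>X. w z) = (\<Sum>x\<in>X. (\<Sum>z\<in>X. M x z) * v x)"
      unfolding w_def sum_distrib_right by (rule sum.swap)
    then show ?thesis by (simp add: row S_def sum_distrib_left)
  qed
  have w2: "(\<Sum>z\<in>X. (w z)\<^sup>2) = k * N + S\<^sup>2 - K"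
  proof -
    have "(\<Sum>z\<in>X. (w z)\<^sup>2) = (\<Sum>z\<in>X. \<Sum>x\<in>X. \<Sum>y\<in>X. v x * v y * (M x z * M y z))"
      unfolding w_def power2_eq_square sum_product by (simp add: mult_ac)
    also have "\<dots> = (\<Sum>x\<in>X. \<Sum>y\<in>X. \<Sum>z\<in>X. v x * v y * (M x z * M y z))"
      by (rule sum_rotate[symmetric])
    also have "\<dots> = (\<Sum>x\<in>X. \<Sum>y\<in>X. k * (v x * v y * of_bool (x = y)) + v x * v y - v x * v y * of_bool (q x = q y))"
      by (intro sum.cong refl) (simp add: sum_distrib_left[symmetric] common algebra_simps)
    also have "\<dots> = k * (\<Sum>x\<in>X. \<Sum>y\<in>X. v x * v y * of_bool (x = y)) + (\<Sum>x\<in>X. \<Sum>y\<in>X. v x * v y) - K"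
      by (simp add: sum.distrib sum_subtractf K_def sum_distrib_left)
    also have "(\<Sum>x\<in>X. \<Sum>y\<in>X. v x * v y * of_bool (x = y)) = N"
      unfolding N_def
      by (intro sum.cong refl)
        (simp add: of_bool_def if_distrib power2_eq_square sum.delta' X cong: if_cong)
    also have "(\<Sum>x\<in>X. \<Sum>y\<in>X. v x * v y) = S\<^sup>2"
      by (simp add: S_def power2_eq_square sum_product)
    finally show ?thesis .
  qed
  \<comment> \<open>\<open>K\<close> is the form of an equivalence relation: a sum over the classes
    of the squared class sums of \<open>v\<close>.\<close>
  have K: "K \<ge> 0"
  proof -
    have "K = (\<Sum>x\<in>X. \<Sum>y\<in>X. \<Sum>c\<in>q ` X. (v x * of_bool (q x = c)) * (v y * of_bool (q y = c)))"
      unfolding K_def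
    proof (intro sum.cong refl)
      fix x y assume "x \<in> X" "y \<in> X"
      have "(\<Sum>c\<in>q ` X. (v x * of_bool (q x = c)) * (v y * of_bool (q y = c)))
          = (\<Sum>c\<in>q ` X. if q x = c then v x * v y * of_bool (q y = c) else 0)"
        by (intro sum.cong refl) auto
      also have "\<dots> = v x * v y * of_bool (q y = q x)"
        using X \<open>x \<in> X\<close> by (simp add: sum.delta)
      finally show "v x * v y * of_bool (q x = q y)
        = (\<Sum>c\<in>q ` X. (v x * of_bool (q x = c)) * (v y * of_bool (q y = c)))"
        by (cases "q x = q y") simp_all
    qed
    also have "\<dots> = (\<Sum>c\<in>q ` X. \<Sum>x\<in>X. \<Sum>y\<in>X. (v x * of_bool (q x = c)) * (v y * of_bool (q y = c)))"
      by (rule sum_rotate)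
    also have "\<dots> = (\<Sum>c\<in>q ` X. (\<Sum>x\<in>X. v x * of_bool (q x = c))\<^sup>2)"
      by (simp only: power2_eq_square sum_product)
    also have "\<dots> \<ge> 0" by (intro sum_nonneg) simp
    finally show ?thesis .
  qed
  have "0 \<le> (\<Sum>z\<in>X. (w z + sqrt k * v z - S / k)\<^sup>2)"
    by (intro sum_nonneg) simp
  also have "\<dots> = (\<Sum>z\<in>X. (w z)\<^sup>2 + k * (v z)\<^sup>2 + (S / k)\<^sup>2 + 2 * sqrt k * (w z * v z)
      - 2 * (S / k) * w z - 2 * sqrt k * (S / k) * v z)"
  proof (intro sum.cong refl)
    fix z
    have "(a + b - c)\<^sup>2 = a\<^sup>2 + b\<^sup>2 + c\<^sup>2 + 2 * (a * b) - 2 * c * a - 2 * (b * c)" for a b c :: real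
      by (simp add: power2_eq_square algebra_simps)
    from this[of "w z" "sqrt k * v z" "S / k"]
    show "(w z + sqrt k * v z - S / k)\<^sup>2 = (w z)\<^sup>2 + k * (v z)\<^sup>2 + (S / k)\<^sup>2 + 2 * sqrt k * (w z * v z)
      - 2 * (S / k) * w z - 2 * sqrt k * (S / k) * v z"
      using k by (simp add: power_mult_distrib mult_ac)
  qed
  also have "\<dots> = (\<Sum>z\<in>X. (w z)\<^sup>2) + k * N + card X * (S / k)\<^sup>2 + 2 * sqrt k * (\<Sum>z\<in>X. w z * v z)
      - 2 * (S / k) * (\<Sum>z\<in>X. w z) - 2 * sqrt k * (S / k) * S"
    by (simp add: sum.distrib sum_subtractf N_def S_def sum_distrib_left)
  also have "\<dots> = 2 * k * N + 2 * sqrt k * Q - K - 2 * sqrt k * S\<^sup>2 / k"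
    unfolding wv w1 w2 X(2) using k by (simp add: power2_eq_square field_simps)
  also have "\<dots> \<le> 2 * k * N + 2 * sqrt k * Q"
  proof -
    have "0 \<le> 2 * sqrt k * S\<^sup>2 / k" using k by simp
    then show ?thesis using K by linarith
  qed
  also have "\<dots> = 2 * sqrt k * (sqrt k * N + Q)"
    using k by (simp add: algebra_simps)
  finally have "0 \<le> sqrt k * N + Q" using k by (simp add: zero_le_mult_iff)
  then show ?thesis by (simp add: N_def Q_def)
qed

section \<open>Spectrum of a regular graph and Hoffman's inequality\<close>

locale regular_nat_graph =
  fixes n k :: nat and G :: "nat pair_pre_digraph"
  assumes verts: "pverts G = {..<n}" and n: "n > 0"
    and arcs: "\<And>a b. (a,b) \<in> parcs G \<Longrightarrow> a < n \<and> b < n"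
    and sym: "\<And>a b. (a,b) \<in> parcs G \<Longrightarrow> (b,a) \<in> parcs G"
    and irrefl: "\<And>a. (a,a) \<notin> parcs G"
    and degree: "\<And>a. a < n \<Longrightarrow> card {b. b < n \<and> (a,b) \<in> parcs G} = k"
begin

definition weight :: "nat \<Rightarrow> nat \<Rightarrow> real" where
  "weight a b = of_bool ((a,b) \<in> parcs G)"

lemma weight_sym: "weight a b = weight b a"
  using sym by (auto simp: weight_def)

lemma weight_row: "a < n \<Longrightarrow> (\<Sum>b<n. weight a b) = k"
  using degree[of a] by (simp add: weight_def Int_def)

lemma weight_col: "b < n \<Longrightarrow> (\<Sum>a<n. weight a b) = k"
  using weight_row[of b] by (simp add: weight_sym[of _ b])

lemma regular_graph: "regular_graph G"
proof -
  have "pair_graph G"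
  proof
    show "finite (parcs G)"
      by (rule finite_subset[of _ "{..<n} \<times> {..<n}"]) (auto dest: arcs)
    show "fst e \<in> pverts G" if "e \<in> parcs G" for e using arcs[of "fst e" "snd e"] that by (simp add: verts)
    show "snd e \<in> pverts G" if "e \<in> parcs G" for e using arcs[of "fst e" "snd e"] that by (simp add: verts)
    show "fst e \<noteq> snd e" if "e \<in> parcs G" for e using irrefl[of "fst e"] that by (metis prod.collapse)
    show "symmetric (with_proj G)" unfolding symmetric_def by (auto intro!: symI sym)
  qed (simp add: verts)
  moreover have "out_degree (with_proj G) v = k" if "v \<in> pverts G" for v
  proof -
    have "out_arcs (with_proj G) v = Pair v ` {b. b < n \<and> (v,b) \<in> parcs G}"
      by (auto simp: image_iff dest: arcs)
    then have "out_degree (with_proj G) v = card (Pair v ` {b. b < n \<and> (v,b) \<in> parcs G})"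
      by (simp only: out_degree_def)
    also have "\<dots> = k"
      using degree[of v] that by (simp add: card_image inj_on_def verts)
    finally show ?thesis .
  qed
  ultimately show ?thesis unfolding regular_graph_def by blast
qed

lemma adjacency_matrix: "adjacency_matrix G = mat n n (\<lambda>(a,b). weight a b)"
  by (simp add: adjacency_matrix_def verts weight_def of_bool_def cong: if_cong)

lemma spectrum_iff:
  "m \<in> spectrum (adjacency_matrix G) \<longleftrightarrow>
    (\<exists>x. (\<exists>a<n. x a \<noteq> 0) \<and> (\<forall>a<n. (\<Sum>b<n. weight a b * x b) = m * x a))"
proof
  assume "m \<in> spectrum (adjacency_matrix G)"
  then obtain v where v: "eigenvector (mat n n (\<lambda>(a,b). weight a b)) v m"
    by (auto simp: spectrum_def eigenvalue_def adjacency_matrix)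
  then have dim: "dim_vec v = n" by (auto simp: eigenvector_def)
  show "\<exists>x. (\<exists>a<n. x a \<noteq> 0) \<and> (\<forall>a<n. (\<Sum>b<n. weight a b * x b) = m * x a)"
  proof (intro exI[of _ "\<lambda>a. v $ a"] conjI allI impI)
    show "\<exists>a<n. v $ a \<noteq> 0" using v dim by (auto simp: eigenvector_def vec_eq_iff)
    fix a assume "a < n"
    moreover have "(mat n n (\<lambda>(a,b). weight a b) *\<^sub>v v) $ a = (m \<cdot>\<^sub>v v) $ a"
      using v by (simp add: eigenvector_def)
    ultimately show "(\<Sum>b<n. weight a b * v $ b) = m * v $ a"
      using dim by (simp add: scalar_prod_def atLeast0LessThan)
  qed
next
  assume "\<exists>x. (\<exists>a<n. x a \<noteq> 0) \<and> (\<forall>a<n. (\<Sum>b<n. weight a b * x b) = m * x a)"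
  then obtain x where x: "\<exists>a<n. x a \<noteq> 0" "\<forall>a<n. (\<Sum>b<n. weight a b * x b) = m * x a" by blast
  have "eigenvector (mat n n (\<lambda>(a,b). weight a b)) (vec n x) m"
    unfolding eigenvector_def
  proof (intro conjI)
    show "vec n x \<noteq> 0\<^sub>v (dim_row (mat n n (\<lambda>(a,b). weight a b)))"
    proof
      assume eq: "vec n x = 0\<^sub>v (dim_row (mat n n (\<lambda>(a,b). weight a b)))"
      obtain a where "a < n" "x a \<noteq> 0" using x(1) by blast
      then show False using arg_cong[OF eq, of "\<lambda>v. v $ a"] by simp
    qed
    show "mat n n (\<lambda>(a,b). weight a b) *\<^sub>v vec n x = m \<cdot>\<^sub>v vec n x"
      using x(2) by (intro eq_vecI) (auto simp: scalar_prod_def atLeast0LessThan)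
  qed simp
  then show "m \<in> spectrum (adjacency_matrix G)"
    by (auto simp: spectrum_def eigenvalue_def adjacency_matrix)
qed

lemma spectrum_form:
  assumes "m \<in> spectrum (adjacency_matrix G)"
  obtains x where "(\<Sum>a<n. (x a)\<^sup>2) > 0"
    "(\<Sum>a<n. \<Sum>b<n. x a * weight a b * x b) = m * (\<Sum>a<n. (x a)\<^sup>2)"
proof -
  obtain x where x: "\<exists>a<n. x a \<noteq> 0" "\<And>a. a < n \<Longrightarrow> (\<Sum>b<n. weight a b * x b) = m * x a"
    using assms unfolding spectrum_iff by blast
  show ?thesis
  proof (rule that)
    show "(\<Sum>a<n. (x a)\<^sup>2) > 0" using x(1) by (auto intro!: sum_pos2)
    have "(\<Sum>a<n. \<Sum>b<n. x a * weight a b * x b) = (\<Sum>a<n. x a * (m * x a))"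
      by (intro sum.cong refl) (simp add: x(2)[symmetric] sum_distrib_left mult.assoc)
    then show "(\<Sum>a<n. \<Sum>b<n. x a * weight a b * x b) = m * (\<Sum>a<n. (x a)\<^sup>2)"
      by (simp add: sum_distrib_left power2_eq_square mult_ac)
  qed
qed

lemma finite_spectrum: "finite (spectrum (adjacency_matrix G))"
  by (rule card_finite_spectrum(1)[of _ n]) (simp add: adjacency_matrix)

lemma degree_in_spectrum: "real k \<in> spectrum (adjacency_matrix G)"
  unfolding spectrum_iff using n by (intro exI[of _ "\<lambda>_. 1"]) (auto simp: weight_row)

text \<open>The inequality \<open>2 x y <= x^2 + y^2\<close> on every edge bounds the quadratic form
  by constant row and column sums.\<close>

lemma spectrum_le_degree:
  assumes "m \<in> spectrum (adjacency_matrix G)"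
  shows "m \<le> k"
proof -
  obtain x where x: "(\<Sum>a<n. (x a)\<^sup>2) > 0"
    "(\<Sum>a<n. \<Sum>b<n. x a * weight a b * x b) = m * (\<Sum>a<n. (x a)\<^sup>2)"
    using assms by (rule spectrum_form)
  have "(\<Sum>a<n. \<Sum>b<n. x a * weight a b * x b)
      \<le> (\<Sum>a<n. \<Sum>b<n. weight a b * (x a)\<^sup>2 / 2 + weight a b * (x b)\<^sup>2 / 2)"
  proof (intro sum_mono)
    fix a b
    have "x a * x b \<le> (x a)\<^sup>2 / 2 + (x b)\<^sup>2 / 2"
      using sum_squares_bound[of "x a" "x b"] by simp
    then have "weight a b * (x a * x b) \<le> weight a b * ((x a)\<^sup>2 / 2 + (x b)\<^sup>2 / 2)"
      by (intro mult_left_mono) (auto simp: weight_def)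
    then show "x a * weight a b * x b \<le> weight a b * (x a)\<^sup>2 / 2 + weight a b * (x b)\<^sup>2 / 2"
      by (simp add: algebra_simps)
  qed
  also have "\<dots> = (\<Sum>a<n. \<Sum>b<n. weight a b * (x a)\<^sup>2 / 2) + (\<Sum>b<n. \<Sum>a<n. weight a b * (x b)\<^sup>2 / 2)"
    unfolding sum.distrib by (intro arg_cong2[where f = "(+)"] refl sum.swap)
  also have "\<dots> = (\<Sum>a<n. k * (x a)\<^sup>2 / 2) + (\<Sum>b<n. k * (x b)\<^sup>2 / 2)"
    by (simp add: sum_divide_distrib[symmetric] sum_distrib_right[symmetric] weight_row weight_col)
  also have "\<dots> = k * (\<Sum>a<n. (x a)\<^sup>2)"
    by (simp add: sum_divide_distrib[symmetric] sum_distrib_left[symmetric])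
  finally show ?thesis using x by simp
qed

lemma lambda_max: "lambda_max G = k"
  unfolding lambda_max_def
  using finite_spectrum degree_in_spectrum spectrum_le_degree by (intro Max_eqI) auto

lemma lambda_min_in_spectrum: "lambda_min G \<in> spectrum (adjacency_matrix G)"
  unfolding lambda_min_def using finite_spectrum degree_in_spectrum by (intro Min_in) auto

lemma lambda_min_ge:
  assumes "\<And>x. - c * (\<Sum>a<n. (x a)\<^sup>2) \<le> (\<Sum>a<n. \<Sum>b<n. x a * weight a b * x b)"
  shows "- c \<le> lambda_min G"
proof -
  obtain x where x: "(\<Sum>a<n. (x a)\<^sup>2) > 0"
    "(\<Sum>a<n. \<Sum>b<n. x a * weight a b * x b) = lambda_min G * (\<Sum>a<n. (x a)\<^sup>2)"
    using lambda_min_in_spectrum by (rule spectrum_form)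
  show ?thesis using assms[of x, unfolded x(2)] x(1) by (rule mult_right_le_imp_le)
qed

text \<open>The spectral theorem yields complex eigenvectors, while \<open>lambda_min\<close> refers
  to the real spectrum. Since the matrix and the eigenvalues are real, real and imaginary parts are
  again solutions, and one of them is nonzero.\<close>

lemma adjacency_eigensystem:
  obtains u l where "orthonormal_eigensystem n (\<lambda>a b. complex_of_real (weight a b)) n u l"
    "\<And>i. i < n \<Longrightarrow> lambda_min G \<le> l i"
proof -
  obtain u l where es: "orthonormal_eigensystem n (\<lambda>a b. complex_of_real (weight a b)) n u l"
    by (rule hermitian_spectral_theorem[of n "\<lambda>a b. complex_of_real (weight a b)"])
      (simp add: weight_sym)
  show ?thesis
  proof (rule that[OF es])
    fix i assume i: "i < n"
    have eig: "(\<Sum>b<n. of_real (weight a b) * u i b) = of_real (l i) * u i a" if "a < n" for a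
      using orthonormal_eigensystemD(2)[OF es i that] .
    have re: "(\<Sum>b<n. weight a b * Re (u i b)) = l i * Re (u i a)" if "a < n" for a
      using arg_cong[OF eig[OF that], of Re] by simp
    have im: "(\<Sum>b<n. weight a b * Im (u i b)) = l i * Im (u i a)" if "a < n" for a
      using arg_cong[OF eig[OF that], of Im] by simp
    have "\<exists>a<n. u i a \<noteq> 0"
    proof (rule ccontr)
      assume "\<not> (\<exists>a<n. u i a \<noteq> 0)"
      then have "(\<Sum>a<n. u i a * cnj (u i a)) = 0" by simp
      then show False using orthonormal_eigensystemD(1)[OF es i i] by simp
    qed
    then consider "\<exists>a<n. Re (u i a) \<noteq> 0" | "\<exists>a<n. Im (u i a) \<noteq> 0" by (auto simp: complex_eq_iff)
    then have "l i \<in> spectrum (adjacency_matrix G)"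
    proof cases
      case 1 then show ?thesis
        unfolding spectrum_iff using re by (intro exI[of _ "\<lambda>a. Re (u i a)"] conjI) simp_all
    next
      case 2 then show ?thesis
        unfolding spectrum_iff using im by (intro exI[of _ "\<lambda>a. Im (u i a)"] conjI) simp_all
    qed
    then show "lambda_min G \<le> l i"
      unfolding lambda_min_def using finite_spectrum by simp
  qed
qed

lemma lambda_min_form:
  "lambda_min G * (\<Sum>a<n. (cmod (z a))\<^sup>2) \<le> Re (\<Sum>a<n. \<Sum>b<n. cnj (z a) * of_real (weight a b) * z b)"
proof -
  obtain u l where es: "orthonormal_eigensystem n (\<lambda>a b. complex_of_real (weight a b)) n u l"
    and l: "\<And>i. i < n \<Longrightarrow> lambda_min G \<le> l i"
    by (rule adjacency_eigensystem) blast
  have "lambda_min G * (\<Sum>a<n. (cmod (z a))\<^sup>2)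
      = (\<Sum>i<n. lambda_min G * (cmod (\<Sum>a<n. cnj (u i a) * z a))\<^sup>2)"
    unfolding parseval[OF es, of z, symmetric] by (rule sum_distrib_left)
  also have "\<dots> \<le> (\<Sum>i<n. l i * (cmod (\<Sum>a<n. cnj (u i a) * z a))\<^sup>2)"
    using l by (intro sum_mono mult_right_mono) auto
  also have "\<dots> = Re (\<Sum>a<n. \<Sum>b<n. cnj (z a) * of_real (weight a b) * z b)"
    unfolding spectral_form[OF es] by simp
  finally show ?thesis .
qed

text \<open>In the absence of loops the form vanishes on a coordinate vector.\<close>

lemma lambda_min_nonpos: "lambda_min G \<le> 0"
proof -
  define z :: "nat \<Rightarrow> complex" where "z a = of_bool (a = 0)" for a
  have "(\<Sum>a<n. (cmod (z a))\<^sup>2) = (\<Sum>a<n. 1 * of_bool (a = 0))"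
    by (intro sum.cong refl) (simp add: z_def)
  also have "\<dots> = 1" using n by (intro sum_of_bool_eq)
  finally have "(\<Sum>a<n. (cmod (z a))\<^sup>2) = 1" .
  moreover have "(\<Sum>a<n. \<Sum>b<n. cnj (z a) * of_real (weight a b) * z b) = 0"
    using irrefl[of 0] by (intro sum.neutral ballI) (auto simp: z_def weight_def intro!: gr0I)
  ultimately show ?thesis using lambda_min_form[of z] by simp
qed

text \<open>The Rayleigh bound is applied to \<open>z\<close> minus its mean; constant vectors have
  eigenvalue \<open>k\<close>. Equivalently, the matrix
  \<open>A - lambda_min I - ((k - lambda_min) / n) J\<close> is positive semidefinite.\<close>

lemma hoffman_form:
  "0 \<le> Re (\<Sum>a<n. \<Sum>b<n. cnj (z a) * of_real (weight a b) * z b)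
     - lambda_min G * (\<Sum>a<n. (cmod (z a))\<^sup>2) - (k - lambda_min G) / n * (cmod (\<Sum>a<n. z a))\<^sup>2"
proof -
  define S where "S = (\<Sum>a<n. z a)"
  define R where "R = Re (\<Sum>a<n. \<Sum>b<n. cnj (z a) * of_real (weight a b) * z b)"
  define c where "c = S / of_nat n"
  have cS: "of_nat n * c = S" using n by (simp add: c_def)
  have norm: "(\<Sum>a<n. (cmod (z a - c))\<^sup>2) = (\<Sum>a<n. (cmod (z a))\<^sup>2) - (cmod S)\<^sup>2 / n"
  proof -
    have "complex_of_real (\<Sum>a<n. (cmod (z a - c))\<^sup>2)
        = (\<Sum>a<n. z a * cnj (z a)) - S * cnj c - c * cnj S + of_nat n * c * cnj c"
      unfolding sum_mult_cnj[symmetric] S_def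
      by (simp add: algebra_simps sum.distrib sum_subtractf sum_distrib_left)
    also have "\<dots> = (\<Sum>a<n. z a * cnj (z a)) - S * cnj S / of_nat n"
      unfolding cS by (simp add: c_def)
    also have "\<dots> = of_real ((\<Sum>a<n. (cmod (z a))\<^sup>2) - (cmod S)\<^sup>2 / n)"
      by (simp only: sum_mult_cnj complex_norm_square[symmetric] of_real_diff of_real_divide of_real_of_nat_eq of_real_sum)
    finally show ?thesis by (simp only: of_real_eq_iff)
  qed
  have col: "(\<Sum>a<n. \<Sum>b<n. cnj (z a) * of_real (weight a b)) = k * cnj S"
    by (simp add: sum_distrib_left[symmetric] of_real_sum[symmetric] weight_row S_def sum_distrib_right[symmetric] mult.commute)
  have row: "(\<Sum>a<n. \<Sum>b<n. of_real (weight a b) * z b) = k * S"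
    by (subst sum.swap)
      (simp add: sum_distrib_right[symmetric] of_real_sum[symmetric] weight_col S_def sum_distrib_left[symmetric])
  have all: "(\<Sum>a<n. \<Sum>b<n. complex_of_real (weight a b)) = of_nat n * k"
    by (simp add: of_real_sum[symmetric] weight_row)
  have "(\<Sum>a<n. \<Sum>b<n. cnj (z a - c) * of_real (weight a b) * (z b - c))
      = (\<Sum>a<n. \<Sum>b<n. cnj (z a) * of_real (weight a b) * z b)
        - (\<Sum>a<n. \<Sum>b<n. cnj (z a) * of_real (weight a b)) * c
        - cnj c * (\<Sum>a<n. \<Sum>b<n. of_real (weight a b) * z b)
        + cnj c * (\<Sum>a<n. \<Sum>b<n. of_real (weight a b)) * c"
    by (simp add: algebra_simps sum.distrib sum_subtractf sum_distrib_left)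
  also have "\<dots> = (\<Sum>a<n. \<Sum>b<n. cnj (z a) * of_real (weight a b) * z b) - of_real (k / n * (cmod S)\<^sup>2)"
    unfolding col row all of_real_mult complex_norm_square using n by (simp add: c_def field_simps)
  finally have "Re (\<Sum>a<n. \<Sum>b<n. cnj (z a - c) * of_real (weight a b) * (z b - c))
      = R - k / n * (cmod S)\<^sup>2"
    unfolding R_def by simp
  then have "lambda_min G * ((\<Sum>a<n. (cmod (z a))\<^sup>2) - (cmod S)\<^sup>2 / n)
      \<le> R - k / n * (cmod S)\<^sup>2"
    using lambda_min_form[of "\<lambda>a. z a - c"] unfolding norm by simp
  moreover have "(k - lambda_min G) / n * (cmod S)\<^sup>2 = k / n * (cmod S)\<^sup>2 - lambda_min G * ((cmod S)\<^sup>2 / n)"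
    by (simp add: diff_divide_distrib left_diff_distrib)
  ultimately show ?thesis
    unfolding S_def[symmetric] R_def[symmetric] by (simp add: right_diff_distrib)
qed

end

section \<open>Quantum homomorphisms and the ratio bound\<close>

lemma hermitian_mat_entry:
  assumes "hermitian_mat P" "P \<in> carrier_mat d d" "a < d" "b < d"
  shows "P $$ (b,a) = cnj (P $$ (a,b))"
proof -
  have "P $$ (b,a) = mat_adjoint P $$ (b,a)" using assms(1) by (simp add: hermitian_mat_def)
  also have "\<dots> = cnj (P $$ (a,b))"
    using assms(2-) by (simp add: mat_adjoint_def mat_of_rows_def)
  finally show ?thesis .
qed

context regular_nat_graph
begin

text \<open>
  The sums \<open>P h\<close> of the projections \<open>E g h\<close> over \<open>g\<close> are the matrix analogue of the indicator
  function of an independent set; Hoffman's argument is applied to each matrix entry separately.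
\<close>

lemma quantum_hom_bound:
  assumes "quantum_hom (complete_graph t) (complement_graph G)"
  shows "(k - lambda_min G) * t \<le> - lambda_min G * n"
proof -
  let ?K = "complete_graph t" and ?H = "complement_graph G"
  obtain d E where d: "d > 0"
    and raw: "\<forall>g\<in>pverts ?K. \<forall>h\<in>pverts ?H. orthogonal_projection d (E g h)"
      "\<forall>g\<in>pverts ?K. mat d d (\<lambda>ij. \<Sum>h\<in>pverts ?H. E g h $$ ij) = 1\<^sub>m d"
      "\<forall>g\<in>pverts ?K. \<forall>g'\<in>pverts ?K. \<forall>h\<in>pverts ?H. \<forall>h'\<in>pverts ?H.
        (g = g' \<and> h \<noteq> h') \<or> ((g,g') \<in> parcs ?K \<and> (h,h') \<notin> parcs ?H) \<longrightarrow> E g h * E g' h' = 0\<^sub>m d d"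
    using assms unfolding quantum_hom_def by blast
  have sets: "pverts ?K = {..<t}" "pverts ?H = {..<n}"
    by (simp_all add: complete_graph_def complement_graph_def verts)
  have proj: "orthogonal_projection d (E g h)" if "g < t" "h < n" for g h
    using raw(1) that by (simp add: sets)
  have total: "mat d d (\<lambda>ij. \<Sum>h<n. E g h $$ ij) = 1\<^sub>m d" if "g < t" for g
    using raw(2) that by (simp add: sets)
  have orth: "E g h * E g' h' = 0\<^sub>m d d"
    if "g < t" "g' < t" "h < n" "h' < n" "(g = g' \<and> h \<noteq> h') \<or> (g \<noteq> g' \<and> (h = h' \<or> (h,h') \<in> parcs G))"
    for g g' h h'
  proof -
    have "(g = g' \<and> h \<noteq> h') \<or> ((g,g') \<in> parcs ?K \<and> (h,h') \<notin> parcs ?H)"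
      using that by (auto simp: complete_graph_def complement_graph_def)
    then show ?thesis using raw(3) that(1-4) unfolding sets by blast
  qed
  have carr: "E g h \<in> carrier_mat d d" "E g h * E g h = E g h" if "g < t" "h < n" for g h
    using proj[OF that] by (auto simp: orthogonal_projection_def)
  define P where "P h a b = (\<Sum>g<t. E g h $$ (a,b))" for h a b
  \<comment> \<open>The Frobenius inner product of \<open>P h\<close> and \<open>P h'\<close>. It
    vanishes on arcs by orthogonality of the projections, just as products of indicator values do
    for an independent set.\<close>
  define T where "T h h' = (\<Sum>a<d. \<Sum>b<d. cnj (P h a b) * P h' a b)" for h h'
  have T_eq: "T h h' = (\<Sum>g<t. \<Sum>g'<t. \<Sum>b<d. (E g h * E g' h') $$ (b,b))"
    if h: "h < n" "h' < n" for h h'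
  proof -
    have "T h h' = (\<Sum>a<d. \<Sum>b<d. \<Sum>g<t. \<Sum>g'<t. E g h $$ (b,a) * E g' h' $$ (a,b))"
      unfolding T_def P_def cnj_sum sum_product
    proof (intro sum.cong refl)
      fix a b g g' assume "a \<in> {..<d}" "b \<in> {..<d}" "g \<in> {..<t}"
      then have "E g h $$ (b,a) = cnj (E g h $$ (a,b))"
        using h proj[of g h] by (intro hermitian_mat_entry) (auto simp: orthogonal_projection_def)
      then show "cnj (E g h $$ (a,b)) * E g' h' $$ (a,b) = E g h $$ (b,a) * E g' h' $$ (a,b)" by simp
    qed
    also have "\<dots> = (\<Sum>g<t. \<Sum>a<d. \<Sum>b<d. \<Sum>g'<t. E g h $$ (b,a) * E g' h' $$ (a,b))"
      by (rule sum_rotate)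
    also have "\<dots> = (\<Sum>g<t. \<Sum>g'<t. \<Sum>a<d. \<Sum>b<d. E g h $$ (b,a) * E g' h' $$ (a,b))"
      by (intro sum.cong refl sum_rotate)
    also have "\<dots> = (\<Sum>g<t. \<Sum>g'<t. \<Sum>b<d. (E g h * E g' h') $$ (b,b))"
    proof (rule sum.cong[OF refl], rule sum.cong[OF refl])
      fix g g' assume "g \<in> {..<t}" "g' \<in> {..<t}"
      then show "(\<Sum>a<d. \<Sum>b<d. E g h $$ (b,a) * E g' h' $$ (a,b)) = (\<Sum>b<d. (E g h * E g' h') $$ (b,b))"
        using carr(1)[of g h] carr(1)[of g' h'] h
        by (subst sum.swap) (intro sum.cong refl, simp add: scalar_prod_def atLeast0LessThan)
    qed
    finally show ?thesis .
  qed
  have T_arc: "T h h' = 0" if "(h,h') \<in> parcs G" for h h'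
  proof -
    have h: "h < n" "h' < n" "h \<noteq> h'" using arcs[OF that] irrefl[of h] that by auto
    have "E g h * E g' h' = 0\<^sub>m d d" if "g < t" "g' < t" for g g'
      using orth[of g g' h h'] that h \<open>(h,h') \<in> parcs G\<close> by blast
    then show ?thesis unfolding T_eq[OF h(1,2)] by (intro sum.neutral ballI) simp
  qed
  have T_diag: "T h h = (\<Sum>g<t. \<Sum>b<d. E g h $$ (b,b))" if "h < n" for h
    unfolding T_eq[OF that that]
  proof (rule sum.cong[OF refl])
    fix g assume g: "g \<in> {..<t}"
    have "(\<Sum>g'<t. \<Sum>b<d. (E g h * E g' h) $$ (b,b))
        = (\<Sum>g'<t. if g' = g then \<Sum>b<d. E g h $$ (b,b) else 0)"
      using orth[of g _ h h] carr(2)[of g h] g that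
      by (intro sum.cong refl) (auto intro!: sum.neutral)
    then show "(\<Sum>g'<t. \<Sum>b<d. (E g h * E g' h) $$ (b,b)) = (\<Sum>b<d. E g h $$ (b,b))"
      using g by simp
  qed
  have total_entry: "(\<Sum>h<n. E g h $$ (a,b)) = of_bool (a = b)" if "g < t" "a < d" "b < d" for g a b
    using arg_cong[OF total[OF that(1)], of "\<lambda>M. M $$ (a,b)"] that by simp
  have trace: "(\<Sum>a<d. \<Sum>b<d. \<Sum>h<n. (cmod (P h a b))\<^sup>2) = real t * real d"
  proof -
    have "complex_of_real (\<Sum>a<d. \<Sum>b<d. \<Sum>h<n. (cmod (P h a b))\<^sup>2)
        = (\<Sum>a<d. \<Sum>b<d. \<Sum>h<n. cnj (P h a b) * P h a b)"
      by (simp only: of_real_sum complex_norm_square mult.commute)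
    also have "\<dots> = (\<Sum>h<n. T h h)" unfolding T_def by (rule sum_rotate)
    also have "\<dots> = (\<Sum>h<n. \<Sum>g<t. \<Sum>b<d. E g h $$ (b,b))"
      by (intro sum.cong refl) (simp add: T_diag)
    also have "\<dots> = (\<Sum>g<t. \<Sum>b<d. \<Sum>h<n. E g h $$ (b,b))"
      by (rule sum_rotate[symmetric])
    also have "\<dots> = (\<Sum>g<t. \<Sum>b<d. 1)"
      by (intro sum.cong refl) (simp add: total_entry)
    also have "\<dots> = complex_of_real (real t * real d)" by simp
    finally show ?thesis by (simp only: of_real_eq_iff)
  qed
  have sums: "(\<Sum>a<d. \<Sum>b<d. (cmod (\<Sum>h<n. P h a b))\<^sup>2) = (real t)\<^sup>2 * real d"
  proof -
    have "(\<Sum>h<n. P h a b) = of_nat t * of_bool (a = b)" if "a < d" "b < d" for a b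
    proof -
      have "(\<Sum>h<n. P h a b) = (\<Sum>g<t. \<Sum>h<n. E g h $$ (a,b))" unfolding P_def by (rule sum.swap)
      then show ?thesis using that by (simp add: total_entry)
    qed
    then have "(\<Sum>a<d. \<Sum>b<d. (cmod (\<Sum>h<n. P h a b))\<^sup>2) = (\<Sum>a<d. \<Sum>b<d. (real t)\<^sup>2 * of_bool (a = b))"
      by (intro sum.cong refl) (simp add: norm_mult power_mult_distrib)
    also have "\<dots> = (\<Sum>a<d. (real t)\<^sup>2)" by (intro sum.cong refl sum_of_bool_eq) simp
    finally show ?thesis by simp
  qed
  have edges: "(\<Sum>a<d. \<Sum>b<d. \<Sum>h<n. \<Sum>h'<n. cnj (P h a b) * of_real (weight h h') * P h' a b) = 0"
  proof -
    have "(\<Sum>a<d. \<Sum>b<d. \<Sum>h<n. \<Sum>h'<n. cnj (P h a b) * of_real (weight h h') * P h' a b)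
        = (\<Sum>h<n. \<Sum>a<d. \<Sum>b<d. \<Sum>h'<n. cnj (P h a b) * of_real (weight h h') * P h' a b)"
      by (rule sum_rotate)
    also have "\<dots> = (\<Sum>h<n. \<Sum>h'<n. \<Sum>a<d. \<Sum>b<d. cnj (P h a b) * of_real (weight h h') * P h' a b)"
      by (intro sum.cong refl sum_rotate)
    also have "\<dots> = (\<Sum>h<n. \<Sum>h'<n. of_real (weight h h') * T h h')"
      by (intro sum.cong refl) (simp add: T_def sum_distrib_left mult_ac)
    also have "\<dots> = 0"
      using T_arc by (intro sum.neutral ballI) (auto simp: weight_def)
    finally show ?thesis .
  qed
  \<comment> \<open>Summed over all entries, the edge term is 0, the squared norms give
    \<open>t * d\<close>, and the squared sums give \<open>t^2 * d\<close>; dividing by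
    \<open>t * d / n\<close> leaves the claim.\<close>
  have "0 \<le> (\<Sum>a<d. \<Sum>b<d. Re (\<Sum>h<n. \<Sum>h'<n. cnj (P h a b) * of_real (weight h h') * P h' a b)
      - lambda_min G * (\<Sum>h<n. (cmod (P h a b))\<^sup>2) - (k - lambda_min G) / n * (cmod (\<Sum>h<n. P h a b))\<^sup>2)"
    by (intro sum_nonneg hoffman_form)
  also have "\<dots> = Re (\<Sum>a<d. \<Sum>b<d. \<Sum>h<n. \<Sum>h'<n. cnj (P h a b) * of_real (weight h h') * P h' a b)
      - lambda_min G * (\<Sum>a<d. \<Sum>b<d. \<Sum>h<n. (cmod (P h a b))\<^sup>2)
      - (k - lambda_min G) / n * (\<Sum>a<d. \<Sum>b<d. (cmod (\<Sum>h<n. P h a b))\<^sup>2)"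
    by (simp only: sum_subtractf Re_sum sum_distrib_left)
  also have "\<dots> = (t * d / n) * (- lambda_min G * n - (k - lambda_min G) * t)"
    unfolding edges trace sums using n by (simp add: power2_eq_square field_simps)
  finally have *: "0 \<le> (t * d / n) * (- lambda_min G * n - (k - lambda_min G) * t)" .
  show ?thesis
  proof (cases "t = 0")
    case True
    then show ?thesis using lambda_min_nonpos by (simp add: mult_nonpos_nonneg)
  next
    case False
    then have "0 < t * d / real n" using d n by simp
    then have "0 \<le> - lambda_min G * n - (k - lambda_min G) * t" using * by (metis linorder_not_le mult_pos_neg)
    then show ?thesis by simp
  qed
qed

text \<open>A classical homomorphism is a quantum one in dimension 1, with projections 0 and
  1.\<close>

lemma independent_set_quantum_hom:
  assumes "independent_set G S"
  shows "quantum_hom (complete_graph (card S)) (complement_graph G)"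
proof -
  have S: "finite S" "S \<subseteq> {..<n}" "\<And>u v. u \<in> S \<Longrightarrow> v \<in> S \<Longrightarrow> (u,v) \<notin> parcs G"
    using assms finite_subset by (auto simp: independent_set_def verts)
  obtain f where f: "bij_betw f {..<card S} S"
    using ex_bij_betw_nat_finite[OF S(1)] by (auto simp: atLeast0LessThan)
  have fS: "f g \<in> S" if "g < card S" for g using f that by (auto simp: bij_betw_def)
  have f_inj: "f g = f g' \<longleftrightarrow> g = g'" if "g < card S" "g' < card S" for g g'
    using f that by (auto simp: bij_betw_def inj_on_def)
  define E :: "nat \<Rightarrow> nat \<Rightarrow> complex mat" where "E g h = mat 1 1 (\<lambda>_. of_bool (h = f g))" for g h
  have prod: "E g h * E g' h' = mat 1 1 (\<lambda>_. of_bool (h = f g \<and> h' = f g'))" for g h g' h'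
    by (intro eq_matI) (auto simp: E_def scalar_prod_def)
  show ?thesis unfolding quantum_hom_def
  proof (intro exI[of _ "1::nat"] exI[of _ E] conjI ballI impI)
    fix g h
    have "mat_adjoint (E g h) = E g h"
      by (intro eq_matI) (auto simp: E_def mat_adjoint_def mat_of_rows_def)
    moreover have "E g h * E g h = E g h" unfolding prod by (simp add: E_def)
    ultimately show "orthogonal_projection 1 (E g h)"
      by (auto simp: orthogonal_projection_def hermitian_mat_def E_def)
  next
    fix g assume "g \<in> pverts (complete_graph (card S))"
    then have "f g < n" using fS[of g] S(2) by (auto simp: complete_graph_def)
    then show "mat 1 1 (\<lambda>ij. \<Sum>h\<in>pverts (complement_graph G). E g h $$ ij) = 1\<^sub>m 1"
      by (intro eq_matI) (auto simp: E_def complement_graph_def verts)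
  next
    fix g g' h h'
    assume "g \<in> pverts (complete_graph (card S))" "g' \<in> pverts (complete_graph (card S))"
      and "g = g' \<and> h \<noteq> h' \<or> (g,g') \<in> parcs (complete_graph (card S)) \<and> (h,h') \<notin> parcs (complement_graph G)"
    then have "\<not> (h = f g \<and> h' = f g')"
      using fS[of g] fS[of g'] f_inj[of g g'] S(2,3)
      by (auto simp: complete_graph_def complement_graph_def verts)
    then show "E g h * E g' h' = 0\<^sub>m 1 1" unfolding prod by (intro eq_matI) auto
  qed simp
qed

lemma quantum_hom_le:
  assumes "k > 0" "quantum_hom (complete_graph t) (complement_graph G)"
  shows "real t \<le> \<bar>lambda_min G / (lambda_max G - lambda_min G)\<bar> * n"
proof -
  have pos: "k - lambda_min G > 0" using assms(1) lambda_min_nonpos by simp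
  have "real t \<le> - lambda_min G * n / (k - lambda_min G)"
    using quantum_hom_bound[OF assms(2)] unfolding pos_le_divide_eq[OF pos] by (simp only: mult.commute)
  also have "\<dots> = \<bar>lambda_min G / (lambda_max G - lambda_min G)\<bar> * n"
    using pos lambda_min_nonpos by (simp add: lambda_max abs_div)
  finally show ?thesis .
qed

text \<open>\<open>Max\<close> in the quantum independence number is meaningful only on a finite
  set; the ratio bound supplies finiteness.\<close>

lemma finite_quantum_homs:
  assumes "k > 0"
  shows "finite {t. quantum_hom (complete_graph t) (complement_graph G)}"
proof (rule finite_subset)
  let ?c = "\<bar>lambda_min G / (lambda_max G - lambda_min G)\<bar> * n"
  show "{t. quantum_hom (complete_graph t) (complement_graph G)} \<subseteq> {..nat \<lceil>?c\<rceil>}"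
  proof
    fix t assume "t \<in> {t. quantum_hom (complete_graph t) (complement_graph G)}"
    then have "real t \<le> ?c" using quantum_hom_le[OF assms] by blast
    also have "?c \<le> real (nat \<lceil>?c\<rceil>)" by (rule real_nat_ceiling_ge)
    finally show "t \<in> {..nat \<lceil>?c\<rceil>}" by simp
  qed
qed simp

lemma independence_number_le_quantum:
  assumes "k > 0"
  shows "independence_number G \<le> quantum_independence_number G"
proof -
  have fin: "finite {card S | S. independent_set G S}"
    by (rule finite_subset[of _ "card ` Pow {..<n}"]) (auto simp: independent_set_def verts)
  moreover have "card {} \<in> {card S | S. independent_set G S}"
    by (auto simp: independent_set_def intro!: exI[of _ "{}"])
  ultimately have "independence_number G \<in> {card S | S. independent_set G S}"
    unfolding independence_number_def by (intro Max_in) auto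
  then have "quantum_hom (complete_graph (independence_number G)) (complement_graph G)"
    using independent_set_quantum_hom by auto
  then show ?thesis
    unfolding quantum_independence_number_def using finite_quantum_homs[OF assms] by (intro Max_ge) auto
qed

lemma quantum_independence_number_le:
  assumes "k > 0"
  shows "quantum_independence_number G \<le> \<bar>lambda_min G / (lambda_max G - lambda_min G)\<bar> * n"
proof -
  \<comment> \<open>Nonemptiness for \<open>Max\<close>: the empty independent set gives
    \<open>t = 0\<close>.\<close>
  have "quantum_hom (complete_graph 0) (complement_graph G)"
    using independent_set_quantum_hom[of "{}"] by (simp add: independent_set_def)
  then have "quantum_independence_number G \<in> {t. quantum_hom (complete_graph t) (complement_graph G)}"
    unfolding quantum_independence_number_def
    using finite_quantum_homs[OF assms] by (intro Max_in) auto
  then show ?thesis using quantum_hom_le[OF assms] by blast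
qed

end

section \<open>The graph\<close>

text \<open>Every fibre has at most two elements. The fibres of interest will be the root sets of
  quadratic equations.\<close>

lemma card_le_twice_card_image:
  assumes "finite A"
    and "\<And>x y z. x \<in> A \<Longrightarrow> y \<in> A \<Longrightarrow> z \<in> A \<Longrightarrow> f x = f y \<Longrightarrow> f y = f z \<Longrightarrow> x = y \<or> y = z \<or> x = z"
  shows "card A \<le> 2 * card (f ` A)"
proof -
  have "card {x \<in> A. f x = y} \<le> 2" for y
  proof (rule ccontr)
    assume "\<not> card {x \<in> A. f x = y} \<le> 2"
    then have "3 \<le> card {x \<in> A. f x = y}" by simp
    then obtain B where B: "B \<subseteq> {x \<in> A. f x = y}" "card B = 3"
      by (metis obtain_subset_with_card_n)
    then obtain u v w where "B = {u, v, w}" "u \<noteq> v" "v \<noteq> w" "u \<noteq> w" by (auto simp: card_3_iff)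
    then show False using B assms(2)[of u v w] by auto
  qed
  then have "(\<Sum>y\<in>f ` A. card {x \<in> A. f x = y}) \<le> card (f ` A) * 2"
    using sum_bounded_above[of "f ` A" "\<lambda>y. card {x \<in> A. f x = y}" 2] by simp
  moreover have "card A = (\<Sum>y\<in>f ` A. card {x \<in> A. f x = y})"
    using sum.image_gen[OF assms(1), of "\<lambda>_. 1::nat" f] by simp
  ultimately show ?thesis by simp
qed

locale nonresidue_graph =
  fixes p g i :: int
  assumes p: "prime p" and i: "p dvd i\<^sup>2 + 1" and g: "\<And>x. \<not> p dvd x\<^sup>2 - g"
begin

lemma prime_dvd_iff: "p dvd x * y \<longleftrightarrow> p dvd x \<or> p dvd y"
  using p by (rule prime_dvd_mult_iff)

lemma prime_dvd_square_iff: "p dvd x\<^sup>2 \<longleftrightarrow> p dvd x"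
  by (simp add: power2_eq_square prime_dvd_iff)

lemma pos: "p > 1" using p by (rule prime_gt_1_int)

lemma not_dvd_g: "\<not> p dvd g" using g[of 0] by simp

lemma not_dvd_i: "\<not> p dvd i"
proof
  assume "p dvd i"
  then have "p dvd (i\<^sup>2 + 1) - i * i" using i by (intro dvd_diff) auto
  then show False using pos by (simp add: power2_eq_square)
qed

lemma not_dvd_2: "\<not> p dvd 2"
proof
  assume "p dvd 2"
  then have "p = 2" using p by (simp add: primes_dvd_imp_eq)
  \<comment> \<open>Modulo 2 every number is its own square, so no nonresidue exists.\<close>
  moreover have "2 dvd g\<^sup>2 - g" by simp
  ultimately show False using g by blast
qed

lemma inverse_exists:
  assumes "\<not> p dvd x"
  obtains w where "p dvd w * x - 1" "\<not> p dvd w"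
proof -
  have "coprime x p" using assms p by (simp add: coprime_commute prime_imp_coprime)
  then obtain w where "[x * w = 1] (mod p)" using cong_solve_coprime_int by blast
  then have w: "p dvd w * x - 1" by (simp add: cong_iff_dvd_diff mult.commute)
  moreover have "\<not> p dvd w"
  proof
    assume "p dvd w"
    then have "p dvd w * x - (w * x - 1)" using w by (rule dvd_diff[OF dvd_mult2])
    then show False using pos by simp
  qed
  ultimately show ?thesis by (rule that)
qed

lemma residue_eqI:
  assumes "x \<in> {0..<p}" "y \<in> {0..<p}" "p dvd x - y"
  shows "x = y"
  using assms by (simp add: mod_eq_dvd_iff[symmetric])

lemma dvd_mod_diff: "p dvd x mod p - x"
  by (simp add: mod_eq_dvd_iff[symmetric])

lemma mod_in_range: "x mod p \<in> {0..<p}" using pos by simp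

definition plane :: "(int \<times> int) set" where
  "plane = {0..<p} \<times> {0..<p}"

definition vertices :: "(int \<times> int) set" where
  "vertices = {(a,b) \<in> plane. \<exists>s. \<not> p dvd s \<and> p dvd 2 * b - a\<^sup>2 - g * s\<^sup>2}"

definition adj :: "int \<times> int \<Rightarrow> int \<times> int \<Rightarrow> bool" where
  "adj x y \<longleftrightarrow> p dvd snd x + snd y - fst x * fst y"

lemma vertices_subset: "vertices \<subseteq> plane" by (auto simp: vertices_def)

lemma finite_plane: "finite plane" by (simp add: plane_def)

lemma card_plane: "card plane = (nat p)\<^sup>2"
  by (simp add: plane_def card_cartesian_product power2_eq_square)

lemma adj_sym: "adj x y \<longleftrightarrow> adj y x"
  by (simp add: adj_def add.commute mult.commute)

text \<open>A loop at \<open>(a, b)\<close> means that the discriminant \<open>2 * b - a^2\<close>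
  vanishes modulo \<open>p\<close>, whereas on vertices it is \<open>g * s^2\<close> with both
  factors nonzero.\<close>

lemma adj_irrefl:
  assumes "x \<in> vertices"
  shows "\<not> adj x x"
proof
  assume "adj x x"
  obtain a b s where x: "x = (a,b)" and s: "\<not> p dvd s" "p dvd 2 * b - a\<^sup>2 - g * s\<^sup>2"
    using assms by (auto simp: vertices_def)
  have "p dvd 2 * b - a\<^sup>2" using \<open>adj x x\<close> by (simp add: x adj_def power2_eq_square)
  then have "p dvd (2 * b - a\<^sup>2) - (2 * b - a\<^sup>2 - g * s\<^sup>2)" using s(2) by (rule dvd_diff)
  then have "p dvd g * s\<^sup>2" by simp
  then show False using not_dvd_g s(1) by (simp add: prime_dvd_iff prime_dvd_square_iff)
qed

text \<open>Subtracting the four adjacency relations leaves \<open>(a - a') * (c - e) = 0\<close>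
  modulo \<open>p\<close>. The first factor vanishing would force \<open>x = y\<close>; the second
  forces \<open>z = w\<close>.\<close>

lemma unique_common_neighbour:
  assumes "x \<in> plane" "y \<in> plane" "z \<in> plane" "w \<in> plane" "x \<noteq> y"
    and adj: "adj x z" "adj z y" "adj x w" "adj w y"
  shows "z = w"
proof -
  obtain a b a' b' c d e f where eq: "x = (a,b)" "y = (a',b')" "z = (c,d)" "w = (e,f)"
    by (metis surj_pair)
  have h: "p dvd b + d - a * c" "p dvd b' + d - a' * c" "p dvd b + f - a * e" "p dvd b' + f - a' * e"
    using adj unfolding adj_def eq by (simp_all add: algebra_simps)
  have "(a - a') * (c - e) = (b + f - a * e) - (b' + f - a' * e) - ((b + d - a * c) - (b' + d - a' * c))"
    by (simp add: algebra_simps)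
  then have "p dvd (a - a') * (c - e)" using h by (metis dvd_diff)
  then consider "p dvd a - a'" | "p dvd c - e" by (auto simp: prime_dvd_iff)
  then show ?thesis
  proof cases
    case 1
    then have a: "a = a'" using assms by (intro residue_eqI) (auto simp: eq plane_def)
    have "p dvd (b + d - a * c) - (b' + d - a' * c)" using h(1,2) by (rule dvd_diff)
    then have "b = b'" using assms by (intro residue_eqI) (auto simp: eq plane_def a)
    then show ?thesis using a assms(5) by (simp add: eq)
  next
    case 2
    then have c: "c = e" using assms by (intro residue_eqI) (auto simp: eq plane_def)
    have "p dvd (b + d - a * c) - (b + f - a * e)" using h(1,3) by (rule dvd_diff)
    then have "d = f" using assms by (intro residue_eqI) (auto simp: eq plane_def c)
    then show ?thesis using c by (simp add: eq)
  qed
qed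

text \<open>
  In a triangle, the three values \<open>2 * b - a\<^sup>2\<close> multiply to a square, whereas on vertices each of
  them is the nonresidue \<open>g\<close> times a square.
\<close>

lemma triangle_free:
  assumes "x \<in> vertices" "y \<in> vertices" "z \<in> vertices" "adj x y" "adj y z"
  shows "\<not> adj z x"
proof
  assume "adj z x"
  obtain a b r where x: "x = (a,b)" and r: "\<not> p dvd r" "p dvd 2 * b - a\<^sup>2 - g * r\<^sup>2"
    using assms(1) by (auto simp: vertices_def)
  obtain c d s where y: "y = (c,d)" and s: "\<not> p dvd s" "p dvd 2 * d - c\<^sup>2 - g * s\<^sup>2"
    using assms(2) by (auto simp: vertices_def)
  obtain e f t where z: "z = (e,f)" and t: "\<not> p dvd t" "p dvd 2 * f - e\<^sup>2 - g * t\<^sup>2"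
    using assms(3) by (auto simp: vertices_def)
  have e1: "p dvd b + d - a * c" and e2: "p dvd d + f - c * e" and e3: "p dvd f + b - e * a"
    using assms(4,5) \<open>adj z x\<close> by (simp_all add: adj_def x y z)
  \<comment> \<open>The three edge relations determine \<open>2 * b\<close>, and the discriminant
    becomes \<open>- (a - c) * (a - e)\<close>; the other two vertices are analogous.\<close>
  have r': "[g * r\<^sup>2 = - ((a - c) * (a - e))] (mod p)"
  proof -
    have "g * r\<^sup>2 - (- ((a - c) * (a - e)))
      = (b + d - a * c) + (f + b - e * a) - (d + f - c * e) - (2 * b - a\<^sup>2 - g * r\<^sup>2)"
      by (simp add: algebra_simps power2_eq_square)
    then show ?thesis using r e1 e2 e3 unfolding cong_iff_dvd_diff by (metis dvd_diff dvd_add)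
  qed
  have s': "[g * s\<^sup>2 = - ((c - a) * (c - e))] (mod p)"
  proof -
    have "g * s\<^sup>2 - (- ((c - a) * (c - e)))
      = (b + d - a * c) + (d + f - c * e) - (f + b - e * a) - (2 * d - c\<^sup>2 - g * s\<^sup>2)"
      by (simp add: algebra_simps power2_eq_square)
    then show ?thesis using s e1 e2 e3 unfolding cong_iff_dvd_diff by (metis dvd_diff dvd_add)
  qed
  have t': "[g * t\<^sup>2 = - ((e - a) * (e - c))] (mod p)"
  proof -
    have "g * t\<^sup>2 - (- ((e - a) * (e - c)))
      = (f + b - e * a) + (d + f - c * e) - (b + d - a * c) - (2 * f - e\<^sup>2 - g * t\<^sup>2)"
      by (simp add: algebra_simps power2_eq_square)
    then show ?thesis using t e1 e2 e3 unfolding cong_iff_dvd_diff by (metis dvd_diff dvd_add)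
  qed
  define S where "S = r * s * t"
  define P where "P = (a - c) * (a - e) * (c - e)"
  have "[g * r\<^sup>2 * (g * s\<^sup>2) * (g * t\<^sup>2)
      = - ((a - c) * (a - e)) * (- ((c - a) * (c - e))) * (- ((e - a) * (e - c)))] (mod p)"
    by (intro cong_mult r' s' t')
  then have "[g * (g * S)\<^sup>2 = P\<^sup>2] (mod p)"
    by (simp add: S_def P_def power2_eq_square algebra_simps)
  \<comment> \<open>Dividing \<open>g * (g * S)^2 = P^2\<close> by \<open>(g * S)^2\<close> would
    exhibit \<open>g\<close> as a square.\<close>
  moreover have "\<not> p dvd g * S" using not_dvd_g r s t by (simp add: S_def prime_dvd_iff)
  then obtain w where "p dvd w * (g * S) - 1" by (rule inverse_exists)
  then have w: "[w * (g * S) = 1] (mod p)" by (simp add: cong_iff_dvd_diff)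
  ultimately have "[w\<^sup>2 * P\<^sup>2 = w\<^sup>2 * (g * (g * S)\<^sup>2)] (mod p)"
    by (intro cong_mult) (auto simp: cong_sym)
  also have "w\<^sup>2 * (g * (g * S)\<^sup>2) = g * (w * (g * S))\<^sup>2"
    by (simp add: power2_eq_square)
  also have "[g * (w * (g * S))\<^sup>2 = g * 1\<^sup>2] (mod p)"
    using w by (intro cong_mult cong_pow) auto
  finally have "p dvd (w * P)\<^sup>2 - g" by (simp add: cong_iff_dvd_diff power_mult_distrib)
  then show False using g by blast
qed

section \<open>Regularity, the degree and the conic\<close>

text \<open>Possible differences of first coordinates between a vertex and its neighbours, divided
  by the root \<open>r\<close> attached to the vertex. After this normalization the condition no
  longer mentions the vertex.\<close>

definition steps :: "int set" where
  "steps = {t \<in> {0..<p}. \<exists>s. \<not> p dvd s \<and> p dvd t\<^sup>2 + g + g * s\<^sup>2}"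

text \<open>The neighbour of \<open>(a, b)\<close> with first coordinate \<open>a + r * t\<close>
  has discriminant \<open>- r^2 * (t^2 + g)\<close>. It equals \<open>g * (r * s)^2\<close> exactly
  when \<open>t^2 + g + g * s^2 = 0\<close>, so \<open>h\<close> is a bijection from
  \<open>steps\<close> onto the neighbours.\<close>

lemma degree:
  assumes "x \<in> vertices"
  shows "card {y \<in> vertices. adj x y} = card steps"
proof -
  obtain a b r where x: "x = (a,b)" and r: "\<not> p dvd r" "p dvd 2 * b - a\<^sup>2 - g * r\<^sup>2"
    using assms by (auto simp: vertices_def)
  obtain w where w: "p dvd w * r - 1" "\<not> p dvd w" using r(1) by (rule inverse_exists)
  define h where "h t = ((a + r * t) mod p, (a * (a + r * t) - b) mod p)" for t
  have "inj_on h steps"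
  proof (rule inj_onI)
    fix t t' assume t: "t \<in> steps" "t' \<in> steps" "h t = h t'"
    then have "p dvd (a + r * t) - (a + r * t')" by (simp add: h_def mod_eq_dvd_iff)
    then have "p dvd r * (t - t')" by (simp add: algebra_simps)
    then have "p dvd t - t'" using r(1) by (simp add: prime_dvd_iff)
    then show "t = t'" using t by (intro residue_eqI) (auto simp: steps_def)
  qed
  moreover have "h ` steps = {y \<in> vertices. adj x y}"
  proof (intro equalityI subsetI)
    fix y assume "y \<in> h ` steps"
    then obtain t s where y: "y = h t" and s: "\<not> p dvd s" "p dvd t\<^sup>2 + g + g * s\<^sup>2"
      by (auto simp: steps_def)
    define k where "k = a + r * t"
    define c where "c = k mod p"
    define d where "d = (a * k - b) mod p"
    have cd: "p dvd c - k" "p dvd d - (a * k - b)" unfolding c_def d_def by (rule dvd_mod_diff)+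
    have "b + d - a * c = (d - (a * k - b)) - a * (c - k)" by (simp add: algebra_simps)
    then have adj: "p dvd b + d - a * c" using cd by (metis dvd_diff dvd_mult)
    have "2 * d - c\<^sup>2 - g * (r * s)\<^sup>2 = 2 * (d - (a * k - b)) - (c + k) * (c - k)
        - (2 * b - a\<^sup>2 - g * r\<^sup>2) - r\<^sup>2 * (t\<^sup>2 + g + g * s\<^sup>2)"
      by (simp add: k_def algebra_simps power2_eq_square)
    then have "p dvd 2 * d - c\<^sup>2 - g * (r * s)\<^sup>2"
      using cd s r(2) by (metis dvd_diff dvd_mult)
    moreover have "\<not> p dvd r * s" using r s by (simp add: prime_dvd_iff)
    ultimately show "y \<in> {y \<in> vertices. adj x y}"
      using adj mod_in_range by (auto simp: y h_def vertices_def plane_def adj_def x k_def c_def d_def)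
  next
    fix y assume "y \<in> {y \<in> vertices. adj x y}"
    then obtain c d s where y: "y = (c,d)" "(c,d) \<in> plane" and s: "\<not> p dvd s" "p dvd 2 * d - c\<^sup>2 - g * s\<^sup>2"
      and adj: "p dvd b + d - a * c"
      by (auto simp: vertices_def adj_def x)
    define t where "t = (w * (c - a)) mod p"
    have t: "p dvd t - w * (c - a)" unfolding t_def by (rule dvd_mod_diff)
    have "(a + r * t) - c = r * (t - w * (c - a)) + (c - a) * (w * r - 1)"
      by (simp add: algebra_simps)
    then have k: "p dvd (a + r * t) - c" using t w(1) by (metis dvd_add dvd_mult)
    have "(a * (a + r * t) - b) - d = a * ((a + r * t) - c) - (b + d - a * c)"
      by (simp add: algebra_simps)
    then have k': "p dvd (a * (a + r * t) - b) - d" using k adj by (metis dvd_diff dvd_mult)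
    have "h t = y"
      using k k' y by (auto simp: h_def plane_def mod_eq_dvd_iff[symmetric])
    moreover have "t \<in> steps"
    proof -
      have "t\<^sup>2 + g + g * (w * s)\<^sup>2 = (t + w * (c - a)) * (t - w * (c - a))
          - g * ((w * r + 1) * (w * r - 1))
          + w\<^sup>2 * (2 * (b + d - a * c) - (2 * b - a\<^sup>2 - g * r\<^sup>2) - (2 * d - c\<^sup>2 - g * s\<^sup>2))"
        by (simp add: algebra_simps power2_eq_square)
      moreover have "p dvd (t + w * (c - a)) * (t - w * (c - a))" "p dvd g * ((w * r + 1) * (w * r - 1))"
        "p dvd w\<^sup>2 * (2 * (b + d - a * c) - (2 * b - a\<^sup>2 - g * r\<^sup>2) - (2 * d - c\<^sup>2 - g * s\<^sup>2))"
        using t w(1) dvd_diff[OF dvd_diff[OF dvd_mult[OF adj, of 2] r(2)] s(2)] 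
        by (simp_all only: dvd_mult)
      ultimately have "p dvd t\<^sup>2 + g + g * (w * s)\<^sup>2" by (metis dvd_diff dvd_add)
      moreover have "\<not> p dvd w * s" using w(2) s by (simp add: prime_dvd_iff)
      ultimately show ?thesis using mod_in_range by (auto simp: steps_def t_def)
    qed
    ultimately show "y \<in> h ` steps" by blast
  qed
  ultimately show ?thesis by (metis card_image)
qed

text \<open>
  The conic \<open>t\<^sup>2 + g + g * s\<^sup>2 = 0\<close> contains the point \<open>(0, i)\<close>; the lines through it
  parametrize the remaining points.
\<close>

lemma card_steps: "p - 1 \<le> 2 * int (card steps)"
proof -
  define m where "m l = l\<^sup>2 + g" for l
  \<comment> \<open>As -1 is the square of \<open>i\<close>, a zero of \<open>m\<close> would make
    \<open>g\<close> a square.\<close>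
  have m: "\<not> p dvd m l" for l
  proof
    assume "p dvd m l"
    moreover have "(i * l)\<^sup>2 - g = (i\<^sup>2 + 1) * l\<^sup>2 - m l"
      by (simp add: m_def algebra_simps power2_eq_square)
    ultimately have "p dvd (i * l)\<^sup>2 - g" using i by (metis dvd_diff dvd_mult2)
    then show False using g by blast
  qed
  have "\<exists>k. p dvd k * m l - 1 \<and> \<not> p dvd k" for l using inverse_exists[OF m] by metis
  then obtain k where k: "p dvd k l * m l - 1" "\<not> p dvd k l" for l by metis
  \<comment> \<open>The second intersection of the conic with the line
    \<open>t = l * (i - s)\<close>; its other coordinate is the \<open>s\<close> defined below,
    which is nonzero because \<open>g\<close> is not a square.\<close>
  define t0 where "t0 l = 2 * i * g * l * k l" for l
  define t where "t l = t0 l mod p" for l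
  have t: "p dvd t l - t0 l" for l unfolding t_def by (rule dvd_mod_diff)
  have "t l \<in> steps" for l
  proof -
    define s where "s = i * (l\<^sup>2 - g) * k l"
    have "(t l)\<^sup>2 + g + g * s\<^sup>2 = (t l + t0 l) * (t l - t0 l)
        + g * (k l * m l)\<^sup>2 * (i\<^sup>2 + 1) - g * (k l * m l + 1) * (k l * m l - 1)"
      by (simp add: s_def t0_def m_def algebra_simps power2_eq_square)
    then have "p dvd (t l)\<^sup>2 + g + g * s\<^sup>2"
      using t[of l] k(1)[of l] i by (metis dvd_diff dvd_add dvd_mult)
    moreover have "\<not> p dvd s" using not_dvd_i k(2) g by (simp add: s_def prime_dvd_iff)
    ultimately show ?thesis using mod_in_range by (auto simp: steps_def t_def)
  qed
  moreover have "finite steps" by (rule finite_subset[of _ "{0..<p}"]) (auto simp: steps_def)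
  ultimately have "card (t ` {1..<p}) \<le> card steps"
    by (intro card_mono) auto
  moreover have "card {1..<p} \<le> 2 * card (t ` {1..<p})"
  proof (rule card_le_twice_card_image)
    fix x y z assume mem: "x \<in> {1..<p}" "y \<in> {1..<p}" "z \<in> {1..<p}" and eq: "t x = t y" "t y = t z"
    have nz: "\<not> p dvd x" using mem by (auto dest: zdvd_imp_le)
    have tx: "\<not> p dvd t x"
    proof
      assume "p dvd t x"
      then have "p dvd t x - (t x - t0 x)" using t by (rule dvd_diff)
      then show False using not_dvd_i not_dvd_g not_dvd_2 nz k(2)
        by (simp add: t0_def prime_dvd_iff)
    qed
    have rel: "p dvd t l * m l - 2 * i * g * l" for l
    proof -
      have "t l * m l - 2 * i * g * l = m l * (t l - t0 l) + 2 * i * g * l * (k l * m l - 1)"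
        by (simp add: t0_def algebra_simps)
      then show ?thesis using t[of l] k(1)[of l] by (metis dvd_add dvd_mult)
    qed
    \<comment> \<open>For a fixed nonzero value \<open>t\<close>, the parameter solves
      \<open>t * l^2 - 2 * i * g * l + t * g = 0\<close>. The sum of two distinct roots is then
      determined, so three distinct parameters cannot share a value.\<close>
    have root: "p dvd t x * (u + v) - 2 * i * g" if uv: "u \<in> {1..<p}" "v \<in> {1..<p}" "t u = t x" "t v = t x" "u \<noteq> v" for u v
    proof -
      have "(u - v) * (t x * (u + v) - 2 * i * g) = (t u * m u - 2 * i * g * u) - (t v * m v - 2 * i * g * v)"
        using uv by (simp add: m_def algebra_simps power2_eq_square)
      then have "p dvd (u - v) * (t x * (u + v) - 2 * i * g)" using rel by (metis dvd_diff)
      moreover have "\<not> p dvd u - v" using residue_eqI[of u v] uv by auto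
      ultimately show ?thesis by (simp add: prime_dvd_iff)
    qed
    show "x = y \<or> y = z \<or> x = z"
    proof (rule ccontr)
      assume neq: "\<not> (x = y \<or> y = z \<or> x = z)"
      have "p dvd (t x * (x + y) - 2 * i * g) - (t x * (x + z) - 2 * i * g)"
        using mem eq neq by (intro dvd_diff[OF root root]) auto
      then have "p dvd t x * (y - z)" by (simp add: algebra_simps)
      then have "p dvd y - z" using tx by (simp add: prime_dvd_iff)
      then show False using neq residue_eqI[of y z] mem by auto
    qed
  qed simp
  ultimately show ?thesis using pos by simp
qed

lemma vertices_nonempty: "vertices \<noteq> {}"
proof -
  obtain w where w: "p dvd w * 2 - 1" using not_dvd_2 by (rule inverse_exists)
  \<comment> \<open>The point \<open>(0, g / 2)\<close> has discriminant \<open>g\<close>.\<close>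
  define b where "b = (w * g) mod p"
  have b: "p dvd b - w * g" unfolding b_def by (rule dvd_mod_diff)
  have "2 * b - 0\<^sup>2 - g * 1\<^sup>2 = 2 * (b - w * g) + g * (w * 2 - 1)" by (simp add: algebra_simps)
  then have "p dvd 2 * b - 0\<^sup>2 - g * 1\<^sup>2" using b w by (metis dvd_add dvd_mult)
  moreover have "\<not> p dvd 1" using pos by simp
  moreover have "(0, b) \<in> plane" using mod_in_range pos by (simp add: plane_def b_def)
  ultimately have "(0, b) \<in> vertices" unfolding vertices_def by blast
  then show ?thesis by blast
qed

section \<open>Common neighbours in the whole plane\<close>

lemma neighbours_plane:
  "{z \<in> plane. adj (a, b) z} = (\<lambda>c. (c, (a * c - b) mod p)) ` {0..<p}"
proof (intro equalityI subsetI)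
  fix z assume "z \<in> {z \<in> plane. adj (a, b) z}"
  then obtain c d where z: "z = (c, d)" "c \<in> {0..<p}" "d \<in> {0..<p}" "p dvd b + d - a * c"
    by (auto simp: plane_def adj_def)
  have "(a * c - b) mod p - d = ((a * c - b) mod p - (a * c - b)) - (b + d - a * c)" by simp
  then have "p dvd (a * c - b) mod p - d" using z(4) dvd_mod_diff by (metis dvd_diff)
  then have "(a * c - b) mod p = d" using z(3) mod_in_range by (intro residue_eqI)
  then show "z \<in> (\<lambda>c. (c, (a * c - b) mod p)) ` {0..<p}" using z by auto
next
  fix z assume "z \<in> (\<lambda>c. (c, (a * c - b) mod p)) ` {0..<p}"
  then obtain c where z: "z = (c, (a * c - b) mod p)" "c \<in> {0..<p}" by auto
  have "b + (a * c - b) mod p - a * c = (a * c - b) mod p - (a * c - b)" by simp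
  then have "p dvd b + (a * c - b) mod p - a * c" using dvd_mod_diff by metis
  then show "z \<in> {z \<in> plane. adj (a, b) z}" using z mod_in_range by (auto simp: plane_def adj_def)
qed

lemma inj_on_neighbours: "inj_on (\<lambda>c. (c, f c)) A"
  by (auto simp: inj_on_def)

lemma card_neighbours_plane: "card {z \<in> plane. adj x z} = nat p"
  by (cases x) (simp add: neighbours_plane card_image inj_on_neighbours)

text \<open>Eliminating the second coordinate of \<open>z = (c, d)\<close> leaves the linear
  equation \<open>(a' - a) * c = b' - b\<close> modulo \<open>p\<close>. Loops of the plane are
  counted too, which keeps the identity for the squared matrix exact.\<close>

lemma card_common_neighbours_plane:
  assumes "x \<in> plane" "y \<in> plane"
  shows "card {z \<in> plane. adj x z \<and> adj y z} = (if x = y then nat p else if fst x = fst y then 0 else 1)"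
proof -
  obtain a b a' b' where xy: "x = (a, b)" "y = (a', b')" by (metis surj_pair)
  have "{z \<in> plane. adj x z \<and> adj y z} = {z \<in> {z \<in> plane. adj (a, b) z}. adj (a', b') z}"
    by (auto simp: xy)
  also have "\<dots> = (\<lambda>c. (c, (a * c - b) mod p)) ` {c \<in> {0..<p}. adj (a', b') (c, (a * c - b) mod p)}"
    unfolding neighbours_plane by auto
  finally have card: "card {z \<in> plane. adj x z \<and> adj y z}
      = card {c \<in> {0..<p}. adj (a', b') (c, (a * c - b) mod p)}"
    by (simp add: card_image inj_on_neighbours)
  have adj: "adj (a', b') (c, (a * c - b) mod p) \<longleftrightarrow> p dvd (b' - b) - (a' - a) * c" for c
  proof -
    have "b' + (a * c - b) mod p - a' * c
        = ((a * c - b) mod p - (a * c - b)) + ((b' - b) - (a' - a) * c)"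
      by (simp add: algebra_simps)
    then show ?thesis unfolding adj_def fst_conv snd_conv by (simp only: dvd_add_right_iff[OF dvd_mod_diff])
  qed
  show ?thesis
  proof (cases "a = a'")
    case True
    have "p dvd b' - b \<longleftrightarrow> b' = b"
      using residue_eqI[of b' b] assms by (auto simp: xy plane_def)
    then have "{c \<in> {0..<p}. p dvd (b' - b) - (a' - a) * c} = (if b = b' then {0..<p} else {})"
      using True by auto
    then show ?thesis using True unfolding card adj by (simp add: xy)
  next
    case False
    then have "\<not> p dvd a' - a" using residue_eqI[of a' a] assms by (auto simp: xy plane_def)
    then obtain w where w: "p dvd w * (a' - a) - 1" by (rule inverse_exists)
    define c where "c = (w * (b' - b)) mod p"
    have c: "p dvd c - w * (b' - b)" unfolding c_def by (rule dvd_mod_diff)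
    have "{c \<in> {0..<p}. p dvd (b' - b) - (a' - a) * c} = {c}"
    proof (intro equalityI subsetI)
      fix e assume e: "e \<in> {c \<in> {0..<p}. p dvd (b' - b) - (a' - a) * c}"
      have "c - e = (c - w * (b' - b)) + w * ((b' - b) - (a' - a) * e) + e * (w * (a' - a) - 1)"
        by (simp add: algebra_simps)
      moreover have "p dvd (b' - b) - (a' - a) * e" using e by simp
      ultimately have "p dvd c - e" using c w by (metis dvd_add dvd_mult)
      then show "e \<in> {c}" using residue_eqI[of c e] e mod_in_range by (auto simp: c_def)
    next
      fix e assume "e \<in> {c}"
      moreover have "(b' - b) - (a' - a) * c = - (a' - a) * (c - w * (b' - b)) - (b' - b) * (w * (a' - a) - 1)"
        by (simp add: algebra_simps)
      then have "p dvd (b' - b) - (a' - a) * c" using c w by (metis dvd_diff dvd_mult)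
      ultimately show "e \<in> {c \<in> {0..<p}. p dvd (b' - b) - (a' - a) * c}"
        using mod_in_range by (auto simp: c_def)
    qed
    then show ?thesis using False unfolding card adj by (simp add: xy)
  qed
qed

end

section \<open>Existence of arbitrarily large parameters\<close>

text \<open>A prime factor of \<open>(fact M)^2 + 1\<close> exceeds \<open>M\<close> and has
  \<open>fact M\<close> as a square root of -1. Squaring identifies 1 and \<open>p - 1\<close>, so
  it is not injective on residues and hence misses some \<open>g\<close>.\<close>

lemma infinitely_many_nonresidue_graphs:
  obtains p g i :: int where "nonresidue_graph p g i" "p > int N"
proof -
  \<comment> \<open>The summand 2 ensures \<open>p > 2\<close>, so that 1 and \<open>p - 1\<close>
    are distinct.\<close>
  define M where "M = N + 2"
  define F where "F = (fact (M))\<^sup>2 + (1::nat)"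
  have "F \<noteq> 1" by (simp add: F_def)
  then obtain q where q: "prime q" "q dvd F" using prime_factor_nat by blast
  have large: "q > M"
  proof (rule ccontr)
    assume "\<not> q > M"
    then have "q dvd fact (M)" by (metis not_less prime_dvd_fact_iff q(1))
    then have "q dvd (fact (M))\<^sup>2" by (simp add: power2_eq_square)
    then have "q dvd 1" using q(2) unfolding F_def by (simp only: dvd_add_right_iff)
    then show False using q(1) by simp
  qed
  define p where "p = int q"
  have p2: "p > 2" using large by (simp add: p_def M_def)
  obtain g where g: "g \<in> {0..<p}" "g \<notin> (\<lambda>x. x\<^sup>2 mod p) ` {0..<p}"
  proof -
    have "\<not> inj_on (\<lambda>x. x\<^sup>2 mod p) {0..<p}"
    proof
      assume "inj_on (\<lambda>x. x\<^sup>2 mod p) {0..<p}"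
      moreover have "(p - 1)\<^sup>2 mod p = 1\<^sup>2 mod p"
      proof -
        have "(p - 1)\<^sup>2 - 1\<^sup>2 = p * (p - 2)" by (simp add: power2_eq_square algebra_simps)
        then show ?thesis by (simp only: mod_eq_dvd_iff dvd_triv_left)
      qed
      ultimately have "p - 1 = 1" by (rule inj_onD) (use p2 in auto)
      then show False using p2 by simp
    qed
    moreover have "(\<lambda>x. x\<^sup>2 mod p) ` {0..<p} \<subseteq> {0..<p}" using p2 by auto
    ultimately have "(\<lambda>x. x\<^sup>2 mod p) ` {0..<p} \<noteq> {0..<p}"
      using finite_surj_inj[of "{0..<p}" "\<lambda>x. x\<^sup>2 mod p"] by blast
    then show ?thesis using that \<open>(\<lambda>x. x\<^sup>2 mod p) ` {0..<p} \<subseteq> {0..<p}\<close> by blast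
  qed
  have "nonresidue_graph p g (fact (M))"
  proof
    show "prime p" using q by (simp add: p_def)
    have "int q dvd int F" using q(2) by (simp only: int_dvd_int_iff)
    then show "p dvd (fact (M))\<^sup>2 + 1" by (simp add: F_def p_def add.commute)
    fix x
    show "\<not> p dvd x\<^sup>2 - g"
    proof
      assume "p dvd x\<^sup>2 - g"
      then have "x\<^sup>2 mod p = g" using g(1) by (simp add: mod_eq_dvd_iff[symmetric])
      then have "(x mod p)\<^sup>2 mod p = g" by (simp add: power_mod)
      moreover have "x mod p \<in> {0..<p}" using p2 by simp
      ultimately show False using g(2) by blast
    qed
  qed
  moreover have "p > int N" using large by (simp add: p_def M_def)
  ultimately show ?thesis by (rule that)
qed

section \<open>Transfer to the vertex set of an initial segment and conclusion\<close>

context nonresidue_graph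
begin

definition numbering :: "nat \<Rightarrow> int \<times> int" where
  "numbering = (SOME f. bij_betw f {..<card vertices} vertices)"

definition nat_graph :: "nat pair_pre_digraph" where
  "nat_graph = \<lparr> pverts = {..<card vertices},
     parcs = {(a,b). a < card vertices \<and> b < card vertices \<and> adj (numbering a) (numbering b)} \<rparr>"

lemma finite_vertices: "finite vertices"
  using vertices_subset finite_plane by (rule finite_subset)

lemma card_vertices_pos: "card vertices > 0"
  using finite_vertices vertices_nonempty by (simp add: card_gt_0_iff)

lemma card_vertices_le: "real (card vertices) \<le> (real_of_int p)\<^sup>2"
proof -
  have "card vertices \<le> (nat p)\<^sup>2"
    using card_mono[OF finite_plane vertices_subset] by (simp add: card_plane)
  then have "real (card vertices) \<le> real ((nat p)\<^sup>2)" by (simp only: of_nat_le_iff)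
  then show ?thesis using pos by simp
qed

lemma numbering: "bij_betw numbering {..<card vertices} vertices"
  unfolding numbering_def
  by (rule someI_ex[where P = "\<lambda>f. bij_betw f {..<card vertices} vertices"])
    (metis ex_bij_betw_nat_finite[OF finite_vertices] atLeast0LessThan)

lemma numbering_in: "a < card vertices \<Longrightarrow> numbering a \<in> vertices"
  using numbering by (auto simp: bij_betw_def)

lemma numbering_in_plane: "a < card vertices \<Longrightarrow> numbering a \<in> plane"
  using numbering_in vertices_subset by blast

lemma numbering_eq_iff:
  "a < card vertices \<Longrightarrow> b < card vertices \<Longrightarrow> numbering a = numbering b \<longleftrightarrow> a = b"
  using numbering by (auto simp: bij_betw_def inj_on_def)

lemma card_steps_le: "card steps \<le> card vertices"
proof -
  obtain x where "x \<in> vertices" using vertices_nonempty by blast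
  then have "card steps = card {y \<in> vertices. adj x y}" by (simp add: degree)
  also have "\<dots> \<le> card vertices" using finite_vertices by (intro card_mono) auto
  finally show ?thesis .
qed

lemma card_steps_pos: "card steps > 0"
  using card_steps pos by linarith

sublocale nat_graph: regular_nat_graph "card vertices" "card steps" nat_graph
proof
  fix a assume a: "a < card vertices"
  have "numbering ` {b. b < card vertices \<and> (a,b) \<in> parcs nat_graph} = {y \<in> vertices. adj (numbering a) y}"
  proof (intro equalityI subsetI)
    fix y assume y: "y \<in> {y \<in> vertices. adj (numbering a) y}"
    then obtain b where "b < card vertices" "y = numbering b"
      using bij_betw_imp_surj_on[OF numbering] by blast
    then show "y \<in> numbering ` {b. b < card vertices \<and> (a,b) \<in> parcs nat_graph}"
      using a y by (auto simp: nat_graph_def)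
  qed (auto simp: nat_graph_def numbering_in)
  moreover have "inj_on numbering {b. b < card vertices \<and> (a,b) \<in> parcs nat_graph}"
    by (rule inj_onI) (simp add: numbering_eq_iff)
  ultimately have "card {b. b < card vertices \<and> (a,b) \<in> parcs nat_graph}
      = card {y \<in> vertices. adj (numbering a) y}"
    using card_image by fastforce
  then show "card {b. b < card vertices \<and> (a,b) \<in> parcs nat_graph} = card steps"
    by (simp only: degree[OF numbering_in[OF a]])
next
  show "(a,a) \<notin> parcs nat_graph" for a
    using adj_irrefl[OF numbering_in[of a]] by (simp add: nat_graph_def)
  show "(b,a) \<in> parcs nat_graph" if "(a,b) \<in> parcs nat_graph" for a b
    using that adj_sym[of "numbering a" "numbering b"] by (simp add: nat_graph_def)
qed (simp_all add: nat_graph_def card_vertices_pos)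

lemma nat_graph_weight:
  "a < card vertices \<Longrightarrow> b < card vertices \<Longrightarrow>
    nat_graph.weight a b = of_bool (adj (numbering a) (numbering b))"
  unfolding nat_graph.weight_def by (simp add: nat_graph_def)

text \<open>A vector on the induced subgraph is extended by zero to the plane, where
  \<open>common_neighbour_form_bound\<close> applies with \<open>q = fst\<close>: distinct points
  without a common neighbour are those sharing their first coordinate.\<close>

lemma nat_graph_form:
  "- sqrt (real_of_int p) * (\<Sum>a<card vertices. (x a)\<^sup>2)
    \<le> (\<Sum>a<card vertices. \<Sum>b<card vertices. x a * nat_graph.weight a b * x b)"
proof -
  let ?n = "card vertices"
  define v where "v y = (if y \<in> vertices then x (inv_into {..<?n} numbering y) else 0)" for y
  have v: "v (numbering a) = x a" if "a < ?n" for a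
    using that numbering numbering_in[OF that]
    by (simp add: v_def bij_betw_def inv_into_f_f)
  have restrict: "(\<Sum>y\<in>plane. h y) = (\<Sum>a<?n. h (numbering a))"
    if "\<And>y. v y = 0 \<Longrightarrow> h y = 0" for h :: "int \<times> int \<Rightarrow> real"
  proof -
    have "(\<Sum>y\<in>plane. h y) = (\<Sum>y\<in>vertices. h y)"
      using that by (intro sum.mono_neutral_right finite_plane vertices_subset) (auto simp: v_def)
    also have "\<dots> = (\<Sum>a<?n. h (numbering a))"
      by (rule sum.reindex_bij_betw[OF numbering, symmetric])
    finally show ?thesis .
  qed
  have "- sqrt (real_of_int p) * (\<Sum>y\<in>plane. (v y)\<^sup>2)
      \<le> (\<Sum>y\<in>plane. \<Sum>z\<in>plane. v y * of_bool (adj y z) * v z)"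
  proof (rule common_neighbour_form_bound[where q = fst])
    show "real (card plane) = (real_of_int p)\<^sup>2" using pos by (simp add: card_plane)
    fix y z assume yz: "y \<in> plane" "z \<in> plane"
    have "(\<Sum>w\<in>plane. of_bool (adj y w) * of_bool (adj z w)) = real (card {w \<in> plane. adj y w \<and> adj z w})"
      by (simp add: of_bool_conj[symmetric] finite_plane Int_def)
    then show "(\<Sum>w\<in>plane. of_bool (adj y w) * of_bool (adj z w))
        = real_of_int p * of_bool (y = z) + 1 - of_bool (fst y = fst z)"
      using pos by (simp add: card_common_neighbours_plane[OF yz])
  next
    fix y
    have "(\<Sum>z\<in>plane. of_bool (adj y z)) = real (card {z \<in> plane. adj y z})"
      by (simp add: finite_plane Int_def)
    then show "(\<Sum>z\<in>plane. of_bool (adj y z)) = real_of_int p"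
      using pos by (simp add: card_neighbours_plane)
  qed (use finite_plane pos in auto)
  also have "(\<Sum>y\<in>plane. (v y)\<^sup>2) = (\<Sum>a<?n. (x a)\<^sup>2)"
    by (subst restrict) (simp_all add: v)
  also have "(\<Sum>y\<in>plane. \<Sum>z\<in>plane. v y * of_bool (adj y z) * v z)
      = (\<Sum>a<?n. \<Sum>b<?n. x a * nat_graph.weight a b * x b)"
    by (subst restrict, simp, subst restrict)
      (simp_all add: v nat_graph_weight)
  finally show ?thesis .
qed

text \<open>From \<open>m <= sqrt p\<close> and \<open>n <= p^2\<close> follows
  \<open>m * n powr (1/4) <= p\<close>, and \<open>p <= 4 * K <= 4 * (K + m)\<close>.\<close>

lemma nat_graph_ratio_bound:
  "\<bar>lambda_min nat_graph / (lambda_max nat_graph - lambda_min nat_graph)\<bar> * real (card vertices)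
    \<le> 4 * real (card vertices) powr (3 / 4)"
proof -
  define n K m where "n = real (card vertices)" and "K = real (card steps)" and "m = - lambda_min nat_graph"
  have n: "n > 0" using card_vertices_pos by (simp add: n_def)
  have K: "K \<ge> 1" using card_steps_pos by (simp add: K_def)
  \<comment> \<open>From \<open>p - 1 <= 2 * K\<close>; the bound \<open>K >= 1\<close> absorbs the
    1.\<close>
  have pK: "real_of_int p \<le> 4 * K" using card_steps K unfolding K_def by linarith
  have m: "0 \<le> m" "m \<le> sqrt (real_of_int p)"
    using nat_graph.lambda_min_nonpos nat_graph.lambda_min_ge[OF nat_graph_form] by (auto simp: m_def)
  have "n powr (1/4) \<le> ((real_of_int p)\<^sup>2) powr (1/4)"
    using card_vertices_le n by (intro powr_mono2) (auto simp: n_def)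
  also have "\<dots> = sqrt (real_of_int p)"
    using pos by (simp add: powr_half_sqrt[symmetric] powr_powr flip: powr_numeral)
  finally have n4: "n powr (1/4) \<le> sqrt (real_of_int p)" .
  have "m * n = (m * n powr (1/4)) * n powr (3/4)"
    using n by (simp add: mult.assoc powr_add[symmetric])
  also have "m * n powr (1/4) \<le> sqrt (real_of_int p) * sqrt (real_of_int p)"
    using m n4 pos by (intro mult_mono) auto
  also have "\<dots> \<le> 4 * (K + m)" using pos pK m by simp
  finally have "m * n \<le> 4 * (K + m) * n powr (3/4)" by (simp add: mult_right_mono)
  then have "m / (K + m) * n \<le> 4 * n powr (3/4)"
    using K m by (simp add: pos_divide_le_eq algebra_simps)
  moreover have "\<bar>lambda_min nat_graph / (lambda_max nat_graph - lambda_min nat_graph)\<bar> = m / (K + m)"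
    using K m by (simp add: nat_graph.lambda_max K_def m_def abs_div)
  ultimately show ?thesis by (simp add: n_def)
qed

lemma nat_graph_inertia:
  assumes "hermitian_weighted_adjacency_matrix nat_graph A"
  shows "real (card vertices) / 4 \<le> num_nonneg_eigenvalues A"
proof -
  let ?n = "card vertices"
  define F where "F a b = A $$ (a,b)" for a b
  have A: "A \<in> carrier_mat ?n ?n" "hermitian_mat A"
    and supp: "\<forall>i<?n. \<forall>j<?n. (i,j) \<notin> parcs nat_graph \<longrightarrow> F i j = 0"
    using assms unfolding hermitian_weighted_adjacency_matrix_def nat_graph.verts card_lessThan F_def
    by blast+
  have herm: "F b a = cnj (F a b)" if "a < ?n" "b < ?n" for a b
    unfolding F_def using A(2,1) that by (rule hermitian_mat_entry)
  obtain u l where es: "orthonormal_eigensystem ?n F ?n u l"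
    using herm by (rule hermitian_spectral_theorem)
  define E where "E a b \<longleftrightarrow> (a,b) \<in> parcs nat_graph" for a b
  have E: "adj (numbering a) (numbering b)" if "E a b" for a b
    using that by (simp add: E_def nat_graph_def)
  have "?n \<le> 4 * card {i. i < ?n \<and> 0 \<le> l i}"
  proof (rule girth_five_inertia[where E = E and k = "card steps", OF herm _ _ _ _ _ _ _ es])
    show "E a b" if "a < ?n" "b < ?n" "F a b \<noteq> 0" for a b using supp that by (auto simp: E_def)
    show "E b a" if "E a b" for a b using nat_graph.sym that by (simp add: E_def)
    show "\<not> E a a" if "a < ?n" for a using nat_graph.irrefl by (simp add: E_def)
    show "\<not> E c a" if "a < ?n" "b < ?n" "c < ?n" "E a b" "E b c" for a b c
      using triangle_free[of "numbering a" "numbering b" "numbering c"] that E numbering_in by blast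
    show "c = d" if "a < ?n" "b < ?n" "c < ?n" "d < ?n" "a \<noteq> b" "E a c" "E c b" "E a d" "E d b" for a b c d
    proof -
      have "numbering c = numbering d"
        using that by (intro unique_common_neighbour[of "numbering a" "numbering b"] numbering_in_plane E)
          (auto simp: numbering_eq_iff)
      then show ?thesis using that by (simp add: numbering_eq_iff)
    qed
    show "card {b. b < ?n \<and> E a b} = card steps" if "a < ?n" for a
      using nat_graph.degree[OF that] by (simp add: E_def)
  qed (use card_steps_pos in auto)
  also have "card {i. i < ?n \<and> 0 \<le> l i} = num_nonneg_eigenvalues (mat ?n ?n (\<lambda>(a,b). F a b))"
    by (rule num_nonneg_eigenvalues_eq_card[OF es, symmetric])
  also have "mat ?n ?n (\<lambda>(a,b). F a b) = A"
    using A by (intro eq_matI) (auto simp: F_def)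
  finally show ?thesis by simp
qed

end

theorem theorem1p6:
  shows "infinite {n :: nat. n > 0 \<and>
    (\<exists>G :: nat pair_pre_digraph. pverts G = {..<n} \<and> regular_graph G \<and>
       independence_number G \<le> quantum_independence_number G \<and>
       real (quantum_independence_number G)
         \<le> \<bar>lambda_min G / (lambda_max G - lambda_min G)\<bar> * real n \<and>
       \<bar>lambda_min G / (lambda_max G - lambda_min G)\<bar> * real n \<le> 4 * real n powr (3 / 4) \<and>
       (\<forall>A. hermitian_weighted_adjacency_matrix G A \<longrightarrow>
          real (num_nonneg_eigenvalues A) \<ge> real n / 4))}"
  unfolding infinite_nat_iff_unbounded
proof (intro allI)
  fix N
  \<comment> \<open>With \<open>p - 1 > 2 * N\<close> the degree, and hence the number of vertices,
    exceeds \<open>N\<close>.\<close>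
  obtain p g i where "nonresidue_graph p g i" and large: "p > int (2 * N + 1)"
    by (rule infinitely_many_nonresidue_graphs)
  then interpret nonresidue_graph p g i by simp
  have gt: "N < card vertices" using card_steps card_steps_le large by linarith
  show "\<exists>n>N. n \<in> {n :: nat. n > 0 \<and>
    (\<exists>G :: nat pair_pre_digraph. pverts G = {..<n} \<and> regular_graph G \<and>
       independence_number G \<le> quantum_independence_number G \<and>
       real (quantum_independence_number G)
         \<le> \<bar>lambda_min G / (lambda_max G - lambda_min G)\<bar> * real n \<and>
       \<bar>lambda_min G / (lambda_max G - lambda_min G)\<bar> * real n \<le> 4 * real n powr (3 / 4) \<and>
       (\<forall>A. hermitian_weighted_adjacency_matrix G A \<longrightarrow>
          real (num_nonneg_eigenvalues A) \<ge> real n / 4))}"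
  proof (intro exI[of _ "card vertices"] conjI CollectI exI[of _ nat_graph] allI impI)
    show "independence_number nat_graph \<le> quantum_independence_number nat_graph"
      by (rule nat_graph.independence_number_le_quantum[OF card_steps_pos])
    show "real (quantum_independence_number nat_graph)
        \<le> \<bar>lambda_min nat_graph / (lambda_max nat_graph - lambda_min nat_graph)\<bar> * real (card vertices)"
      by (rule nat_graph.quantum_independence_number_le[OF card_steps_pos])
  qed (fact gt card_vertices_pos nat_graph.verts nat_graph.regular_graph nat_graph_ratio_bound | erule nat_graph_inertia)+
qed

end
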